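(* Let $G$ be a linear group and let $L$ be a finitely generated model of the universal theory of $G$ (i.e., $L$ is a finitely generated $G$-limit group). Then $\mathrm{Rk}(L)$ is finite.
   Context: A linear group is a subgroup of $GL_m(K)$ for some $m\ge 1$ and some field $K$. The language is the language of groups $\{\cdot,{}^{-1},1\}$, and the universal theory of $G$ is the set of universal first-order sentences true in $G$. For a linear group $G$ (which is equationally noetherian), the finitely generated $G$-limit groups are exactly the finitely generated models of the universal theory of $G$. Cantor-Bendixson rank. For a compact Hausdorff space $X$ put $D(X)=\{x\in X : x \text{ is not isolated in } X\}$, $D^0(X)=X$, $D^{\alpha+1}(X)=D(D^\alpha(X))$ (isolation taken in the subspace $D^\alpha(X)$), and $D^\alpha(X)=\bigcap_{\beta<\alpha}D^\beta(X)$ for limit ordinals $\alpha$. For $x\in X$, $CB(x)=\alpha$ if and only if $x\in D^\alpha(X)\setminus D^{\alpha+1}(X)$. If $X$ is countable and is a space $S_n^{qf}(T)$ as below, $CB(x)$ is an ordinal for every $x\in X$. Types. Let $T$ be a universal theory. A complete $n$-QF-type with respect to $T$ is a set $p(\bar x)$, $|\bar x|=n$, of quantifier-free formulas (without parameters) such that for every quantifier-free formula $\psi(\bar x)$ either $\psi\in p$ or $\neg\psi\in p$, and such that some model $\mathcal M$ of $T$ contains a tuple $\bar a$ with $\mathcal M\models p(\bar a)$. $S_n^{qf}(T)$ is the set of all complete $n$-QF-types, with the topology having as basis the sets $[\psi]=\{p : \psi\in p\}$, $\psi(\bar x)$ quantifier-free; it is compact and totally disconnected. The rank $\mathrm{Rk}$.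 Suppose $T$ has at most countably many finitely generated models up to isomorphism (this holds when $T$ is the universal theory of a linear group). For a model $\mathcal M$ of $T$ generated by an $n$-tuple $\bar a$, put $\Delta(\mathcal M,\bar a)=\{\psi(\bar x) : \psi \text{ quantifier-free},\ \mathcal M\models\psi(\bar a)\}\in S_n^{qf}(T)$ and $\mathrm{Rk}_n(\mathcal M,\bar a)=CB(\Delta(\mathcal M,\bar a))+1$, with $CB$ computed in $S_n^{qf}(T)$. This ordinal does not depend on the choice of the finite generating tuple $\bar a$ (nor on its length $n$), and is denoted $\mathrm{Rk}(\mathcal M)$. In the claim, $\mathrm{Rk}(L)$ is computed with $T$ the universal theory of $G$. *)

theory Defs
  imports "HOL-Analysis.Analysis" "HOL-Algebra.Algebra" "Jordan_Normal_Form.Matrix"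
begin

subsection \<open>Linear groups\<close>

definition GL :: "'k::field itself \<Rightarrow> nat \<Rightarrow> 'k mat monoid" where
  "GL ty m = units_of (ring_mat ty m ())"

definition linear_group :: "'k::field mat monoid \<Rightarrow> bool" where
  "linear_group G \<longleftrightarrow>
     (\<exists>m\<ge>1. \<exists>H. subgroup H (GL TYPE('k) m) \<and> G = (GL TYPE('k) m)\<lparr>carrier := H\<rparr>)"


subsection \<open>First-order logic in the language of groups\<close>

datatype gterm = TVar nat | TOne | TInv gterm | TMult gterm gterm

datatype gformula = FEq gterm gterm | FNeg gformula | FConj gformula gformula | FAll nat gformula

primrec tvars :: "gterm \<Rightarrow> nat set" where
  "tvars (TVar i) = {i}"
| "tvars TOne = {}"
| "tvars (TInv t) = tvars t"
| "tvars (TMult s t) = tvars s \<union> tvars t"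

primrec fvars :: "gformula \<Rightarrow> nat set" where
  "fvars (FEq s t) = tvars s \<union> tvars t"
| "fvars (FNeg f) = fvars f"
| "fvars (FConj f g) = fvars f \<union> fvars g"
| "fvars (FAll i f) = fvars f - {i}"

primrec qfree :: "gformula \<Rightarrow> bool" where
  "qfree (FEq s t) \<longleftrightarrow> True"
| "qfree (FNeg f) \<longleftrightarrow> qfree f"
| "qfree (FConj f g) \<longleftrightarrow> qfree f \<and> qfree g"
| "qfree (FAll i f) \<longleftrightarrow> False"

definition universal_sentence :: "gformula \<Rightarrow> bool" where
  "universal_sentence f \<longleftrightarrow> fvars f = {} \<and> (\<exists>is g. qfree g \<and> f = foldr FAll is g)"

primrec tval :: "'a monoid \<Rightarrow> (nat \<Rightarrow> 'a) \<Rightarrow> gterm \<Rightarrow> 'a" where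
  "tval M e (TVar i) = e i"
| "tval M e TOne = \<one>\<^bsub>M\<^esub>"
| "tval M e (TInv t) = inv\<^bsub>M\<^esub> (tval M e t)"
| "tval M e (TMult s t) = tval M e s \<otimes>\<^bsub>M\<^esub> tval M e t"

primrec sat :: "'a monoid \<Rightarrow> (nat \<Rightarrow> 'a) \<Rightarrow> gformula \<Rightarrow> bool" where
  "sat M e (FEq s t) \<longleftrightarrow> tval M e s = tval M e t"
| "sat M e (FNeg f) \<longleftrightarrow> \<not> sat M e f"
| "sat M e (FConj f g) \<longleftrightarrow> sat M e f \<and> sat M e g"
| "sat M e (FAll i f) \<longleftrightarrow> (\<forall>a\<in>carrier M. sat M (e(i := a)) f)"

definition holds :: "'a monoid \<Rightarrow> gformula \<Rightarrow> bool" where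
  "holds M f \<longleftrightarrow> (\<forall>e. range e \<subseteq> carrier M \<longrightarrow> sat M e f)"

definition universal_theory :: "'a monoid \<Rightarrow> gformula set" where
  "universal_theory G = {f. universal_sentence f \<and> holds G f}"

text \<open>
  The group axioms are universal sentences, so every model of the universal theory of a group is a
  group; accordingly only groups are admitted as structures, and the symbol for inversion is
  interpreted by the inverse of the group.
\<close>

definition model :: "gformula set \<Rightarrow> 'a monoid \<Rightarrow> bool" where
  "model T M \<longleftrightarrow> group M \<and> (\<forall>f\<in>T. holds M f)"

definition generating_tuple :: "'a monoid \<Rightarrow> 'a list \<Rightarrow> bool" where
  "generating_tuple M as \<longleftrightarrow> set as \<subseteq> carrier M \<and> generate M (set as) = carrier M"

definition finitely_generated :: "'a monoid \<Rightarrow> bool" where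
  "finitely_generated M \<longleftrightarrow> (\<exists>as. generating_tuple M as)"


subsection \<open>Quantifier-free types\<close>

definition qf_formulas :: "nat \<Rightarrow> gformula set" where
  "qf_formulas n = {f. qfree f \<and> fvars f \<subseteq> {..<n}}"

text \<open>
  A formula in the variables \<open>0, \<dots>, n - 1\<close> is evaluated at an \<open>n\<close>-tuple \<open>as\<close> through the
  assignment \<open>nth as\<close>, whose values beyond \<open>n\<close> are irrelevant.
\<close>

definition qf_type :: "'a monoid \<Rightarrow> 'a list \<Rightarrow> gformula set" where
  "qf_type M as = {f \<in> qf_formulas (length as). sat M (nth as) f}"

text \<open>
  Realising models are taken with carrier in \<^typ>\<open>nat\<close>, since HOL cannot quantify over types in a
  definition. For a universal theory nothing is lost: a tuple in a model on any type generates a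
  countable submodel; see \<open>qf_type_in_qf_types\<close> below.
\<close>

definition qf_types :: "gformula set \<Rightarrow> nat \<Rightarrow> gformula set set" where
  "qf_types T n = {p. p \<subseteq> qf_formulas n
     \<and> (\<forall>f\<in>qf_formulas n. f \<in> p \<or> FNeg f \<in> p)
     \<and> (\<exists>(M :: nat monoid) as. model T M \<and> length as = n \<and> set as \<subseteq> carrier M
           \<and> (\<forall>f\<in>p. sat M (nth as) f))}"

definition qf_type_space :: "gformula set \<Rightarrow> nat \<Rightarrow> gformula set topology" where
  "qf_type_space T n =
     topology_generated_by ((\<lambda>f. {p \<in> qf_types T n. f \<in> p}) ` qf_formulas n)"


subsection \<open>Cantor--Bendixson rank\<close>

definition non_isolated :: "'x topology \<Rightarrow> 'x set \<Rightarrow> 'x set" where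
  "non_isolated S A = {x \<in> A. \<not> openin (subtopology S A) {x}}"

text \<open>
  Ordinals are represented by the elements of a well-ordered type, \<open>\<alpha>\<close> standing for the order type
  of \<open>{..<\<alpha>}\<close>; the elements of \<^typ>\<open>nat\<close> are thus the finite ordinals. The single recursion
  equation covers the zero, successor and limit clauses, which are derived below.
\<close>

function cb_derivative :: "'x topology \<Rightarrow> 'o::wellorder \<Rightarrow> 'x set" where
  "cb_derivative S \<alpha> = topspace S \<inter> (\<Inter>\<beta>\<in>{..<\<alpha>}. non_isolated S (cb_derivative S \<beta>))"
  by auto
termination
  by (relation "inv_image {(\<beta>, \<alpha>). \<beta> < \<alpha>} snd") (auto intro: wf)

declare cb_derivative.simps [simp del]

definition has_cb_rank :: "'x topology \<Rightarrow> 'x \<Rightarrow> 'o::wellorder \<Rightarrow> bool" where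
  "has_cb_rank S x \<alpha> \<longleftrightarrow> x \<in> cb_derivative S \<alpha> - non_isolated S (cb_derivative S \<alpha>)"

text \<open>The condition \<open>{..<\<alpha>} = {..\<beta>}\<close> says that \<open>\<alpha> = \<beta> + 1\<close>.\<close>

definition has_Rk_at :: "gformula set \<Rightarrow> 'a monoid \<Rightarrow> 'a list \<Rightarrow> 'o::wellorder \<Rightarrow> bool" where
  "has_Rk_at T M as \<alpha> \<longleftrightarrow>
     (\<exists>\<beta>. has_cb_rank (qf_type_space T (length as)) (qf_type M as) \<beta> \<and> {..<\<alpha>} = {..\<beta>})"

text \<open>\<open>Rk(M)\<close> is the common value of the ranks at all finite generating tuples.\<close>

definition has_Rk :: "gformula set \<Rightarrow> 'a monoid \<Rightarrow> 'o::wellorder \<Rightarrow> bool" where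
  "has_Rk T M \<alpha> \<longleftrightarrow>
     finitely_generated M \<and> (\<forall>as. generating_tuple M as \<longrightarrow> has_Rk_at T M as \<alpha>)"


subsection \<open>The defining clauses of the Cantor--Bendixson derivatives\<close>

lemma cb_derivative_zero: "cb_derivative S \<alpha> = topspace S" if "{..<\<alpha>} = {}"
  using that by (simp add: cb_derivative.simps[of S \<alpha>])

lemma cb_derivative_antimono: "\<beta> \<le> \<alpha> \<Longrightarrow> cb_derivative S \<alpha> \<subseteq> cb_derivative S \<beta>"
  unfolding cb_derivative.simps[of S \<alpha>] cb_derivative.simps[of S \<beta>]
  by (auto dest: less_le_trans)

lemma non_isolated_subset: "non_isolated S A \<subseteq> A"
  by (auto simp: non_isolated_def)

lemma cb_derivative_below:
  "\<beta> < \<alpha> \<Longrightarrow> cb_derivative S \<alpha> \<subseteq> non_isolated S (cb_derivative S \<beta>)"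
  unfolding cb_derivative.simps[of S \<alpha>] by auto

lemma cb_derivative_succ:
  assumes "{..<\<alpha>} = {..\<beta>}"
  shows "cb_derivative S \<alpha> = non_isolated S (cb_derivative S \<beta>)"
proof
  have "\<beta> < \<alpha>" using assms by blast
  then show "cb_derivative S \<alpha> \<subseteq> non_isolated S (cb_derivative S \<beta>)"
    by (rule cb_derivative_below)
next
  have sub: "non_isolated S (cb_derivative S \<beta>) \<subseteq> non_isolated S (cb_derivative S \<gamma>)"
    if "\<gamma> \<le> \<beta>" for \<gamma>
  proof (cases "\<gamma> = \<beta>")
    case False
    then have "\<gamma> < \<beta>" using that by simp
    then show ?thesis
      using cb_derivative_below[of \<gamma> \<beta> S] non_isolated_subset[of S "cb_derivative S \<beta>"] by blast
  qed auto
  have "cb_derivative S \<beta> \<subseteq> topspace S"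
    unfolding cb_derivative.simps[of S \<beta>] by auto
  then have "non_isolated S (cb_derivative S \<beta>) \<subseteq> topspace S"
    using non_isolated_subset[of S "cb_derivative S \<beta>"] by blast
  then show "non_isolated S (cb_derivative S \<beta>) \<subseteq> cb_derivative S \<alpha>"
    using sub unfolding cb_derivative.simps[of S \<alpha>] assms by auto
qed

lemma cb_derivative_limit:
  assumes "{..<\<alpha>} \<noteq> {}" and "\<And>\<beta>. \<beta> < \<alpha> \<Longrightarrow> \<exists>\<gamma>. \<beta> < \<gamma> \<and> \<gamma> < \<alpha>"
  shows "cb_derivative S \<alpha> = (\<Inter>\<beta>\<in>{..<\<alpha>}. cb_derivative S \<beta>)"
proof
  show "cb_derivative S \<alpha> \<subseteq> (\<Inter>\<beta>\<in>{..<\<alpha>}. cb_derivative S \<beta>)"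
    using cb_derivative_antimono[of _ \<alpha> S] by (auto dest!: less_imp_le)
next
  obtain \<beta>0 where b0: "\<beta>0 < \<alpha>" using assms(1) by blast
  have "cb_derivative S \<beta>0 \<subseteq> topspace S"
    unfolding cb_derivative.simps[of S \<beta>0] by auto
  moreover have "(\<Inter>\<beta>\<in>{..<\<alpha>}. cb_derivative S \<beta>) \<subseteq> non_isolated S (cb_derivative S \<beta>)"
    if "\<beta> < \<alpha>" for \<beta>
    using assms(2)[OF that] cb_derivative_below[of \<beta> _ S] by blast
  ultimately show "(\<Inter>\<beta>\<in>{..<\<alpha>}. cb_derivative S \<beta>) \<subseteq> cb_derivative S \<alpha>"
    using b0 unfolding cb_derivative.simps[of S \<alpha>] by blast
qed


subsection \<open>Types realised in models on arbitrary types\<close>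

instance gterm :: countable
  by countable_datatype

lemma tval_closed:
  assumes "group M" "\<And>i. i \<in> tvars t \<Longrightarrow> e i \<in> carrier M"
  shows "tval M e t \<in> carrier M"
proof -
  interpret group M by fact
  show ?thesis using assms(2) by (induction t) auto
qed

lemma tval_hom:
  assumes "group_hom A B h" "\<And>i. i \<in> tvars t \<Longrightarrow> e i \<in> carrier A"
  shows "tval B (h \<circ> e) t = h (tval A e t)"
proof -
  interpret group_hom A B h by fact
  show ?thesis using assms(2)
    by (induction t) (auto simp: tval_closed)
qed

lemma sat_embedding:
  assumes "group_hom A B h" "inj_on h (carrier A)" "qfree f"
    "\<And>i. i \<in> fvars f \<Longrightarrow> e i \<in> carrier A"
  shows "sat B (h \<circ> e) f \<longleftrightarrow> sat A e f"
  using assms(3,4)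
proof (induction f)
  case (FEq s t)
  interpret group_hom A B h by fact
  have "tval A e s \<in> carrier A" "tval A e t \<in> carrier A"
    using FEq by (auto intro!: tval_closed)
  moreover have "tval B (h \<circ> e) s = h (tval A e s)" "tval B (h \<circ> e) t = h (tval A e t)"
    using FEq by (auto intro!: tval_hom assms(1))
  ultimately show ?case unfolding sat.simps using inj_onD[OF assms(2)] by metis
qed auto

lemma sat_universal_embedding:
  assumes "group_hom A B h" "inj_on h (carrier A)" "qfree g"
  shows "range e \<subseteq> carrier A \<Longrightarrow> sat B (h \<circ> e) (foldr FAll is g) \<Longrightarrow> sat A e (foldr FAll is g)"
proof (induction "is" arbitrary: e)
  case Nil
  then have "e i \<in> carrier A" for i by auto
  with Nil.prems(2) show ?case by (simp add: sat_embedding[OF assms] del: o_apply)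
next
  case (Cons i "is")
  interpret group_hom A B h by fact
  show ?case
  proof (simp, intro ballI)
    fix a assume a: "a \<in> carrier A"
    have "sat B ((h \<circ> e)(i := h a)) (foldr FAll is g)"
      using Cons.prems(2) a by (simp add: comp_def)
    also have "(h \<circ> e)(i := h a) = h \<circ> e(i := a)" by auto
    finally have *: "sat B (h \<circ> e(i := a)) (foldr FAll is g)" .
    have "range (e(i := a)) \<subseteq> carrier A" using Cons.prems(1) a by auto
    from Cons.IH[OF this *] show "sat A (e(i := a)) (foldr FAll is g)"
      .
  qed
qed

lemma model_embedding:
  assumes "group_hom A B h" "inj_on h (carrier A)" "model T B" "\<And>f. f \<in> T \<Longrightarrow> universal_sentence f"
  shows "model T A"
proof -
  interpret group_hom A B h by fact
  have "holds A f" if f: "f \<in> T" for f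
  proof -
    obtain "is" g where g: "qfree g" "f = foldr FAll is g"
      using assms(4)[OF f] by (auto simp: universal_sentence_def)
    show ?thesis unfolding holds_def
    proof (intro allI impI)
      fix e :: "nat \<Rightarrow> 'a" assume e: "range e \<subseteq> carrier A"
      then have "range (h \<circ> e) \<subseteq> carrier B" by auto
      then have "sat B (h \<circ> e) f"
        using assms(3) f by (auto simp: model_def holds_def)
      then show "sat A e f"
        using sat_universal_embedding[OF assms(1,2) g(1) e] g(2) by simp
    qed
  qed
  then show ?thesis by (simp add: model_def)
qed

lemma generate_tval:
  assumes "x \<in> generate M (set as)"
  shows "\<exists>t. x = tval M (nth as) t"
  using assms
proof induction
  case one
  show ?case by (metis tval.simps(2))
next
  case (incl h)
  then show ?case by (metis in_set_conv_nth tval.simps(1))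
next
  case (inv h)
  then show ?case by (metis in_set_conv_nth tval.simps(1,3))
next
  case (eng h1 h2)
  then show ?case by (metis tval.simps(4))
qed

lemma countable_submodel:
  fixes M :: "'a monoid"
  assumes M: "group M" and as: "set as \<subseteq> carrier M"
  obtains N :: "nat monoid" and h where
    "group_hom N M h" "inj_on h (carrier N)" "h ` carrier N = generate M (set as)"
proof -
  interpret group M by fact
  define S where "S = generate M (set as)"
  have sub: "subgroup S M" unfolding S_def by (rule generate_is_subgroup[OF as])
  let ?S = "M\<lparr>carrier := S\<rparr>"
  interpret S: group ?S by (rule subgroup.subgroup_is_group[OF sub M])
  have "S \<subseteq> range (tval M (nth as))"
    using generate_tval unfolding S_def by fast
  then have cnt: "countable S" by (rule countable_subset) auto
  define c where "c = to_nat_on S"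
  define d where "d = inv_into S c"
  have inj: "inj_on c S" unfolding c_def by (rule inj_on_to_nat_on[OF cnt])
  have dc: "d (c x) = x" if "x \<in> S" for x using inj that by (simp add: d_def)
  define N :: "nat monoid" where
    "N = \<lparr>carrier = c ` S, mult = (\<lambda>x y. c (d x \<otimes>\<^bsub>M\<^esub> d y)), one = c \<one>\<^bsub>M\<^esub>\<rparr>"
  have "c \<in> hom ?S N"
    by (auto simp: hom_def N_def dc)
  from S.hom_imp_img_group[OF this] have N: "group N"
    by (simp add: N_def)
  have "d \<in> hom N M"
    using sub subgroup.m_closed[OF sub] subgroup.subset[OF sub] by (auto simp: hom_def N_def dc)
  then have "group_hom N M d"
    using N M by (simp add: group_hom_def group_hom_axioms_def)
  moreover have "inj_on d (carrier N)"
    by (auto simp: N_def inj_on_def dc)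
  moreover have "d ` carrier N = generate M (set as)"
    by (auto simp: N_def dc image_image S_def[symmetric])
  ultimately show ?thesis by (rule that)
qed

lemma qf_type_in_qf_types:
  fixes M :: "'a monoid"
  assumes "model T M" "\<And>f. f \<in> T \<Longrightarrow> universal_sentence f" "set as \<subseteq> carrier M"
  shows "qf_type M as \<in> qf_types T (length as)"
proof -
  have M: "group M" using assms(1) by (simp add: model_def)
  obtain N :: "nat monoid" and h where N: "group_hom N M h" "inj_on h (carrier N)"
    "h ` carrier N = generate M (set as)"
    using countable_submodel[OF M assms(3)] .
  have "set as \<subseteq> h ` carrier N" using N(3) by (auto intro: generate.incl)
  then obtain bs where bs: "set bs \<subseteq> carrier N" "as = map h bs"
  proof -
    define bs where "bs = map (inv_into (carrier N) h) as"
    have "set bs \<subseteq> carrier N"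
      using \<open>set as \<subseteq> h ` carrier N\<close> by (auto simp: bs_def intro!: inv_into_into)
    moreover have "as = map h bs"
      using \<open>set as \<subseteq> h ` carrier N\<close>
      by (auto simp: bs_def f_inv_into_f subset_iff intro!: map_idI[symmetric])
    ultimately show ?thesis by (rule that)
  qed
  have "sat N (nth bs) f" if "f \<in> qf_type M as" for f
  proof -
    have f: "qfree f" "fvars f \<subseteq> {..<length bs}" "sat M (nth as) f"
      using that bs(2) by (auto simp: qf_type_def qf_formulas_def)
    have "sat M e f = sat M e' f" if "qfree f" "\<And>i. i \<in> fvars f \<Longrightarrow> e i = e' i" for e e' f
    proof -
      have t: "(\<And>i. i \<in> tvars t \<Longrightarrow> e i = e' i) \<Longrightarrow> tval M e t = tval M e' t" for t
        by (induction t) auto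
      show ?thesis using that
      proof (induction f)
        case (FEq s t)
        then show ?case using t[of s] t[of t] by auto
      qed auto
    qed
    moreover have "nth as i = (h \<circ> nth bs) i" if "i \<in> fvars f" for i
      using f(2) bs(2) that by auto
    ultimately have "sat M (h \<circ> nth bs) f"
      using f(1,3) by blast
    then show ?thesis
      using sat_embedding[OF N(1,2) f(1), of "nth bs"] f(2) bs(1) by (auto simp: subset_iff)
  qed
  moreover have "model T N" by (rule model_embedding[OF N(1,2) assms(1,2)])
  moreover have "length bs = length as" using bs(2) by simp
  moreover have "f \<in> qf_type M as \<or> FNeg f \<in> qf_type M as" if "f \<in> qf_formulas (length as)" for f
    using that by (auto simp: qf_type_def qf_formulas_def)
  ultimately show ?thesis
    using bs(1) by (auto simp: qf_types_def qf_type_def)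
qed

end

theory Submission
  imports Defs "HOL-Library.Function_Algebras" "HOL-Computational_Algebra.Polynomial"
begin

text \<open>
  The rank of \<open>L\<close> is finite because quantifier-free types over a linear group are controlled by
  prime ideals in a commutative ring of finite Krull dimension.

  Let \<open>G\<close> consist of \<open>m \<times> m\<close> matrices over the field \<open>K\<close>, and let \<open>A\<close> be the \<open>K\<close>-algebra of functions
  \<open>G\<^sup>n \<rightarrow> K\<close> generated by the entries of the coordinates and of their inverses. An equation
  \<open>s = t\<close> between group words amounts to the vanishing of finitely many elements of \<open>A\<close>, namely
  the entries of \<open>s - t\<close>. A prime ideal \<open>P\<close> of \<open>A\<close> lies over a type \<open>p\<close> if the equations in \<open>p\<close> are
  exactly those whose entries belong to \<open>P\<close>; then \<open>P\<close> determines \<open>p\<close>.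

  A type in the \<open>d\<close>-th Cantor--Bendixson derivative lies under a prime ideal above which there is a
  chain of \<open>d\<close> strict inclusions. For \<open>d = 0\<close> this holds because a type is a limit of
  types of points of \<open>G\<^sup>n\<close>, since each formula of the type is satisfied in \<open>G\<close>, and the functions vanishing at
  a point form a prime ideal. For the induction step, let \<open>p\<close> be a limit of types \<open>q \<noteq> p\<close> in the
  \<open>d\<close>-th derivative, with primes \<open>Q\<close> over them. An ideal maximal among those that are contained in such
  a \<open>Q\<close> for \<open>q\<close> arbitrarily close to \<open>p\<close> is a prime \<open>P\<close> over \<open>p\<close> (\<open>prime_limit\<close>,
  \<open>prime_over_limit_type\<close>). It is contained in some \<open>Q\<close>, and properly so because the two lie over
  different types (\<open>cb_derivative_prime_rank\<close>).

  Maximal ideals of this kind exist because \<open>A\<close> is Noetherian (\<open>hilbert_basis\<close>), and the length of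
  chains of primes is bounded because each added generator at most doubles the number of primes in
  a chain: two comparable primes of \<open>A[x]\<close> with the same contraction to \<open>A\<close> differ in whether \<open>x\<close>
  is algebraic modulo them (\<open>fibre_primes\<close>). Polynomials in several variables are avoided by
  adjoining the generators one at a time inside a fixed ambient ring.

  Hence some finite derivative of the space of \<open>n\<close>-types is empty. Two generating tuples of \<open>L\<close> are
  expressed through each other by words, and substitution of these words identifies
  neighbourhoods of their types; this respects the derivatives
  (\<open>cb_derivative_generating_tuple\<close>), so that the same finite rank arises at every generating tuple.
\<close>

text \<open>The short names are to mean the operations on type \<open>poly\<close>, not those on records and lists.\<close>

hide_const (open) Polynomials.degree Polynomials.lead_coeff up_ring.coeff up_ring.monom module.smult

section \<open>Subrings and their ideals\<close>

locale ring_subset =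
  fixes A :: "'r::comm_ring_1 set"
  assumes one_mem: "1 \<in> A"
    and diff_mem: "a \<in> A \<Longrightarrow> b \<in> A \<Longrightarrow> a - b \<in> A"
    and mult_mem: "a \<in> A \<Longrightarrow> b \<in> A \<Longrightarrow> a * b \<in> A"
begin

lemma zero_mem: "0 \<in> A"
  using diff_mem[OF one_mem one_mem] by simp

lemma uminus_mem: "a \<in> A \<Longrightarrow> - a \<in> A"
  using diff_mem[OF zero_mem] by simp

lemma add_mem: "a \<in> A \<Longrightarrow> b \<in> A \<Longrightarrow> a + b \<in> A"
  using diff_mem[OF _ uminus_mem] by simp

lemma sum_mem: "(\<And>i. i \<in> S \<Longrightarrow> f i \<in> A) \<Longrightarrow> sum f S \<in> A"
  by (induction S rule: infinite_finite_induct) (auto intro: zero_mem add_mem)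

lemma power_mem: "a \<in> A \<Longrightarrow> a ^ k \<in> A"
  by (induction k) (auto intro: one_mem mult_mem)

end

definition ideal_in :: "'r::comm_ring_1 set \<Rightarrow> 'r set \<Rightarrow> bool" where
  "ideal_in A I \<longleftrightarrow> I \<subseteq> A \<and> 0 \<in> I \<and> (\<forall>a\<in>I. \<forall>b\<in>I. a + b \<in> I) \<and> (\<forall>r\<in>A. \<forall>a\<in>I. r * a \<in> I)"

definition prime_in :: "'r::comm_ring_1 set \<Rightarrow> 'r set \<Rightarrow> bool" where
  "prime_in A P \<longleftrightarrow> ideal_in A P \<and> 1 \<notin> P \<and> (\<forall>a\<in>A. \<forall>b\<in>A. a * b \<in> P \<longrightarrow> a \<in> P \<or> b \<in> P)"

text \<open>
  The Noetherian property, stated through chains: this is the form that passes directly from the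
  leading coefficients to the ideals in \<open>hilbert_basis\<close>.
\<close>

definition ideal_chains_stabilise :: "'r::comm_ring_1 set \<Rightarrow> bool" where
  "ideal_chains_stabilise A \<longleftrightarrow>
     (\<forall>I. (\<forall>k::nat. ideal_in A (I k)) \<and> incseq I \<longrightarrow> (\<exists>k. \<forall>j\<ge>k. I j = I k))"

lemma ideal_sub: "ideal_in A I \<Longrightarrow> a \<in> I \<Longrightarrow> a \<in> A"
  and ideal_zero: "ideal_in A I \<Longrightarrow> 0 \<in> I"
  and ideal_add: "ideal_in A I \<Longrightarrow> a \<in> I \<Longrightarrow> b \<in> I \<Longrightarrow> a + b \<in> I"
  and ideal_mult: "ideal_in A I \<Longrightarrow> r \<in> A \<Longrightarrow> a \<in> I \<Longrightarrow> r * a \<in> I"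
  by (auto simp: ideal_in_def)

lemma ideal_sum: "ideal_in A I \<Longrightarrow> (\<And>i. i \<in> S \<Longrightarrow> f i \<in> I) \<Longrightarrow> sum f S \<in> I"
  by (induction S rule: infinite_finite_induct) (auto intro: ideal_zero ideal_add)

context ring_subset
begin

lemma ideal_diff: "ideal_in A I \<Longrightarrow> a \<in> I \<Longrightarrow> b \<in> I \<Longrightarrow> a - b \<in> I"
  using ideal_add[of A I a "- 1 * b"] ideal_mult[of A I "- 1" b] uminus_mem[OF one_mem] by simp

lemma ideal_plus_principal:
  assumes "ideal_in A I" "f \<in> A"
  shows "ideal_in A {a + r * f | a r. a \<in> I \<and> r \<in> A}"
    and "I \<subseteq> {a + r * f | a r. a \<in> I \<and> r \<in> A}"
    and "f \<in> {a + r * f | a r. a \<in> I \<and> r \<in> A}"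
proof -
  show "I \<subseteq> {a + r * f | a r. a \<in> I \<and> r \<in> A}"
  proof
    fix a assume "a \<in> I"
    then show "a \<in> {a + r * f | a r. a \<in> I \<and> r \<in> A}"
      by (intro CollectI exI[of _ a] exI[of _ 0]) (auto simp: zero_mem)
  qed
  then have z: "0 \<in> {a + r * f | a r. a \<in> I \<and> r \<in> A}"
    using ideal_zero[OF assms(1)] by blast
  show "f \<in> {a + r * f | a r. a \<in> I \<and> r \<in> A}"
    by (intro CollectI exI[of _ 0] exI[of _ 1]) (auto simp: one_mem ideal_zero[OF assms(1)])
  have "a + r * f \<in> A" if "a \<in> I" "r \<in> A" for a r
    using that assms by (auto intro!: add_mem mult_mem dest: ideal_sub)
  moreover have "\<exists>a'' r''. (a + r * f) + (a' + r' * f) = a'' + r'' * f \<and> a'' \<in> I \<and> r'' \<in> A"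
    if "a \<in> I" "r \<in> A" "a' \<in> I" "r' \<in> A" for a r a' r'
    using that assms by (intro exI[of _ "a + a'"] exI[of _ "r + r'"])
      (auto simp: algebra_simps intro: add_mem ideal_add)
  moreover have "\<exists>a'' r''. s * (a + r * f) = a'' + r'' * f \<and> a'' \<in> I \<and> r'' \<in> A"
    if "a \<in> I" "r \<in> A" "s \<in> A" for a r s
    using that assms by (intro exI[of _ "s * a"] exI[of _ "s * r"])
      (auto simp: distrib_left mult.assoc intro: mult_mem ideal_mult)
  ultimately show "ideal_in A {a + r * f | a r. a \<in> I \<and> r \<in> A}"
    using z unfolding ideal_in_def by (auto; blast)
qed

text \<open>
  Otherwise dependent choice yields a strictly increasing chain of ideals satisfying \<open>C\<close>.
\<close>

lemma maximal_ideal_with: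
  assumes "ideal_chains_stabilise A" and "ideal_in A I0" "C I0"
  shows "\<exists>I. ideal_in A I \<and> C I \<and> (\<forall>J. ideal_in A J \<longrightarrow> C J \<longrightarrow> I \<subseteq> J \<longrightarrow> J = I)"
proof (rule ccontr)
  assume neg: "\<not> ?thesis"
  define next_ideal where "next_ideal I = (SOME J. ideal_in A J \<and> C J \<and> I \<subseteq> J \<and> J \<noteq> I)" for I
  have step: "ideal_in A (next_ideal I) \<and> C (next_ideal I) \<and> I \<subseteq> next_ideal I \<and> next_ideal I \<noteq> I"
    if "ideal_in A I" "C I" for I
  proof -
    have "\<exists>J. ideal_in A J \<and> C J \<and> I \<subseteq> J \<and> J \<noteq> I" using neg that by metis
    then show ?thesis unfolding next_ideal_def by (rule someI_ex)
  qed
  define I where "I k = (next_ideal ^^ k) I0" for k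
  have I: "ideal_in A (I k) \<and> C (I k)" for k
    by (induction k) (simp_all add: I_def assms step)
  then have strict: "I k \<subseteq> I (Suc k)" "I (Suc k) \<noteq> I k" for k
    using step[of "I k"] by (simp_all add: I_def)
  have "incseq I" by (intro incseq_SucI strict)
  then obtain k where k: "\<forall>j\<ge>k. I j = I k"
    using I assms(1) unfolding ideal_chains_stabilise_def by blast
  have "I (Suc k) = I k" by (rule k[rule_format]) simp
  then show False using strict(2)[of k] by simp
qed

end

section \<open>Adjoining one element: the Noetherian property\<close>

definition polys_over :: "'r::comm_ring_1 set \<Rightarrow> 'r poly set" where
  "polys_over A = {p. \<forall>i. coeff p i \<in> A}"

text \<open>
  Evaluation need not be injective: \<open>x\<close> may satisfy relations over \<open>A\<close>.
\<close>

definition adjoin :: "'r::comm_ring_1 set \<Rightarrow> 'r \<Rightarrow> 'r set" where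
  "adjoin A x = (\<lambda>p. poly p x) ` polys_over A"

context ring_subset
begin

lemma polys_over_closed:
  "p \<in> polys_over A \<Longrightarrow> q \<in> polys_over A \<Longrightarrow> p + q \<in> polys_over A"
  "p \<in> polys_over A \<Longrightarrow> q \<in> polys_over A \<Longrightarrow> p - q \<in> polys_over A"
  "p \<in> polys_over A \<Longrightarrow> q \<in> polys_over A \<Longrightarrow> p * q \<in> polys_over A"
  "a \<in> A \<Longrightarrow> monom a k \<in> polys_over A"
  "a \<in> A \<Longrightarrow> p \<in> polys_over A \<Longrightarrow> smult a p \<in> polys_over A"
  "0 \<in> polys_over A"
  by (auto simp: polys_over_def coeff_mult zero_mem intro: add_mem diff_mem mult_mem sum_mem)

lemma mem_adjoin: "a \<in> A \<Longrightarrow> a \<in> adjoin A x"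
  unfolding adjoin_def
  by (rule image_eqI[where x="monom a 0"]) (auto simp: poly_monom polys_over_closed)

lemma adjoined_mem: "x \<in> adjoin A x"
  unfolding adjoin_def
  by (rule image_eqI[where x="monom 1 1"]) (auto simp: poly_monom polys_over_closed one_mem)

lemma poly_mem_adjoin: "p \<in> polys_over A \<Longrightarrow> poly p x \<in> adjoin A x"
  by (auto simp: adjoin_def)

lemma ring_subset_adjoin: "ring_subset (adjoin A x)"
proof
  show "1 \<in> adjoin A x" by (rule mem_adjoin[OF one_mem])
next
  fix a b assume "a \<in> adjoin A x" "b \<in> adjoin A x"
  then obtain p q where "p \<in> polys_over A" "q \<in> polys_over A" "a = poly p x" "b = poly q x"
    by (auto simp: adjoin_def)
  then show "a - b \<in> adjoin A x" "a * b \<in> adjoin A x"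
    by (auto simp flip: poly_diff poly_mult intro!: poly_mem_adjoin polys_over_closed)
qed

lemma remove_leading_term:
  assumes "p \<in> polys_over A" "q \<in> polys_over A" "degree p \<le> d" "degree q \<le> d"
    "coeff p d = coeff q d" "0 < d"
  shows "degree (p - q) < d"
proof -
  have "coeff (p - q) d = 0" using assms by simp
  moreover have "degree (p - q) \<le> d" using assms by (intro degree_diff_le)
  ultimately show ?thesis using assms(6)
    by (metis leading_coeff_0_iff degree_0 le_neq_implies_less)
qed

text \<open>
  Hilbert's basis theorem. An ideal of \<open>A[x]\<close> is determined, relative to a smaller one, by the
  ideals of coefficients in degree \<open>d\<close> of the polynomials of degree at most \<open>d\<close> that it contains:
  if these agree, one lowers degrees by subtraction. For a chain of ideals they form a family
  increasing both in the chain index and in \<open>d\<close>, so the diagonal and finitely many columns suffice to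
  make the entire family stabilise.
\<close>

theorem hilbert_basis:
  assumes stab: "ideal_chains_stabilise A"
  shows "ideal_chains_stabilise (adjoin A x)"
  unfolding ideal_chains_stabilise_def
proof (intro allI impI, elim conjE)
  fix I
  assume I: "\<forall>k. ideal_in (adjoin A x) (I k)" and inc: "incseq I"
  interpret B: ring_subset "adjoin A x" by (rule ring_subset_adjoin)
  have Imono: "I k \<subseteq> I l" if "k \<le> l" for k l using inc that by (simp add: incseq_def)
  define Lc where "Lc k d = {coeff p d | p. p \<in> polys_over A \<and> degree p \<le> d \<and> poly p x \<in> I k}" for k d
  have Lc_ideal: "ideal_in A (Lc k d)" for k d
    unfolding ideal_in_def
  proof (intro conjI ballI subsetI)
    note Ik = I[rule_format, of k]
    show "a \<in> A" if "a \<in> Lc k d" for a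
      using that by (auto simp: Lc_def polys_over_def)
    show "0 \<in> Lc k d"
      unfolding Lc_def by (intro CollectI exI[of _ 0]) (auto simp: polys_over_closed ideal_zero[OF Ik])
    show "a + b \<in> Lc k d" if "a \<in> Lc k d" "b \<in> Lc k d" for a b
    proof -
      from that obtain p q where "p \<in> polys_over A" "degree p \<le> d" "poly p x \<in> I k" "a = coeff p d"
        "q \<in> polys_over A" "degree q \<le> d" "poly q x \<in> I k" "b = coeff q d"
        by (auto simp: Lc_def)
      then show ?thesis unfolding Lc_def
        by (intro CollectI exI[of _ "p + q"])
          (auto intro: polys_over_closed ideal_add[OF Ik] degree_add_le)
    qed
    show "r * a \<in> Lc k d" if "r \<in> A" "a \<in> Lc k d" for r a
    proof -
      from that obtain p where "p \<in> polys_over A" "degree p \<le> d" "poly p x \<in> I k" "a = coeff p d"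
        by (auto simp: Lc_def)
      then show ?thesis using that(1) unfolding Lc_def
        by (intro CollectI exI[of _ "smult r p"])
          (auto intro: polys_over_closed ideal_mult[OF Ik] mem_adjoin order_trans[OF degree_smult_le])
    qed
  qed
  have Lc_mono1: "Lc k d \<subseteq> Lc l d" if "k \<le> l" for k l d
    using Imono[OF that] unfolding Lc_def by auto
  have Lc_shift: "Lc k d \<subseteq> Lc k (d + e)" for k d e
  proof
    fix a assume "a \<in> Lc k d"
    then obtain p where p: "p \<in> polys_over A" "degree p \<le> d" "poly p x \<in> I k" "a = coeff p d"
      by (auto simp: Lc_def)
    have "degree (monom 1 e * p) \<le> d + e"
      by (subst add.commute, rule order_trans[OF degree_mult_le add_mono[OF degree_monom_le p(2)]])
    moreover have "poly (monom 1 e * p) x \<in> I k"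
      using p(3) I by (auto simp: poly_monom intro!: ideal_mult B.power_mem adjoined_mem)
    moreover have "coeff (monom 1 e * p) (d + e) = a"
      using p(4) by (simp add: coeff_monom_mult)
    ultimately show "a \<in> Lc k (d + e)"
      using p(1) unfolding Lc_def
      by (intro CollectI exI[of _ "monom 1 e * p"]) (auto intro!: polys_over_closed one_mem)
  qed
  have Lc_mono2: "Lc k d \<subseteq> Lc k e" if "d \<le> e" for k d e
    using Lc_shift[of k d "e - d"] that by simp
  have chain: "\<exists>k. \<forall>j\<ge>k. J j = J k" if "\<And>k. ideal_in A (J k)" "incseq J" for J :: "nat \<Rightarrow> _"
    using stab that unfolding ideal_chains_stabilise_def by blast
  \<comment> \<open>The diagonal takes care of all degrees from \<open>k0\<close> on; each of the finitely many smaller degrees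
    is stable from \<open>\<kappa> d\<close> on.\<close>
  have "incseq (\<lambda>k. Lc k k)"
    unfolding incseq_def using Lc_mono1 Lc_mono2 by blast
  then obtain k0 where k0: "\<And>j. j \<ge> k0 \<Longrightarrow> Lc j j = Lc k0 k0"
    using chain[of "\<lambda>k. Lc k k"] Lc_ideal by blast
  have "\<exists>k. \<forall>j\<ge>k. Lc j d = Lc k d" for d
    using chain[of "\<lambda>k. Lc k d"] Lc_ideal Lc_mono1 by (auto simp: incseq_def)
  then obtain \<kappa> where \<kappa>: "\<And>d j. j \<ge> \<kappa> d \<Longrightarrow> Lc j d = Lc (\<kappa> d) d" by metis
  define K where "K = Max (insert k0 (\<kappa> ` {..<k0}))"
  have K: "k0 \<le> K" "d < k0 \<Longrightarrow> \<kappa> d \<le> K" for d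
    unfolding K_def by (auto intro: Max_ge)
  have Lc_K: "Lc j d = Lc K d" if "j \<ge> K" for j d
  proof (cases "d < k0")
    case True
    then show ?thesis using \<kappa>[of d j] \<kappa>[of d K] K(2)[OF True] that by simp
  next
    case False
    have "Lc j d \<subseteq> Lc (max j d) (max j d)"
      using Lc_mono1[of j "max j d" d] Lc_mono2[of d "max j d" "max j d"] by auto
    also have "\<dots> = Lc k0 k0" using K(1) that by (intro k0) simp
    also have "\<dots> \<subseteq> Lc K d"
      using Lc_mono1[OF K(1), of k0] Lc_mono2[of k0 d K] False by auto
    finally show ?thesis using Lc_mono1[OF that, of d] by blast
  qed
  have "poly p x \<in> I K" if j: "j \<ge> K" and "p \<in> polys_over A" "poly p x \<in> I j" for j p
    using that(2,3)
  proof (induction "degree p" arbitrary: p rule: less_induct)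
    case less
    then have "coeff p (degree p) \<in> Lc j (degree p)" by (auto simp: Lc_def)
    then obtain q where q: "q \<in> polys_over A" "degree q \<le> degree p" "poly q x \<in> I K"
      "coeff p (degree p) = coeff q (degree p)"
      unfolding Lc_K[OF j] by (auto simp: Lc_def)
    show ?case
    proof (cases "degree p = 0")
      case True
      then have "p = q" using q(2,4) by (metis degree_eq_zeroE coeff_pCons_0 le_zero_eq)
      then show ?thesis using q(3) by simp
    next
      case False
      have "poly (p - q) x \<in> I j"
        using less.prems q(3) Imono[OF j] I by (auto intro!: B.ideal_diff)
      then have "poly (p - q) x \<in> I K"
        using False q less.prems
        by (intro less.hyps) (auto intro: remove_leading_term polys_over_closed)
      then show ?thesis using ideal_add[OF I[rule_format] _ q(3)] by fastforce
    qed
  qed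
  then have "I j \<subseteq> I K" if "j \<ge> K" for j
    using that I ideal_sub[of "adjoin A x" "I j"] unfolding adjoin_def by blast
  then show "\<exists>k. \<forall>j\<ge>k. I j = I k" using Imono by blast
qed

end

section \<open>Chains of prime ideals\<close>

definition algebraic_mod :: "'r::comm_ring_1 set \<Rightarrow> 'r \<Rightarrow> 'r set \<Rightarrow> bool" where
  "algebraic_mod A x P \<longleftrightarrow> (\<exists>f\<in>polys_over A. poly f x \<in> P \<and> (\<exists>i. coeff f i \<notin> P))"

text \<open>
  A witness that chains of primes have at most \<open>b + 1\<close> members. An explicit rank function, rather
  than the supremum of lengths of chains, is what the recursion over generators produces.
\<close>

definition strict_prime_rank :: "'r::comm_ring_1 set \<Rightarrow> ('r set \<Rightarrow> nat) \<Rightarrow> nat \<Rightarrow> bool" where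
  "strict_prime_rank A \<phi> b \<longleftrightarrow> (\<forall>P. prime_in A P \<longrightarrow> \<phi> P \<le> b)
     \<and> (\<forall>P Q. prime_in A P \<longrightarrow> prime_in A Q \<longrightarrow> P \<subset> Q \<longrightarrow> \<phi> Q < \<phi> P)"

lemma prime_ideal: "prime_in A P \<Longrightarrow> ideal_in A P"
  by (simp add: prime_in_def)

lemma prime_mult_iff:
  "prime_in A P \<Longrightarrow> a \<in> A \<Longrightarrow> b \<in> A \<Longrightarrow> a * b \<in> P \<longleftrightarrow> a \<in> P \<or> b \<in> P"
  unfolding prime_in_def by (metis ideal_mult mult.commute)

context ring_subset
begin

lemma prime_power_notin:
  "prime_in A P \<Longrightarrow> a \<in> A \<Longrightarrow> a \<notin> P \<Longrightarrow> a ^ k \<notin> P"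
  by (induction k) (auto simp: prime_mult_iff power_mem, auto simp: prime_in_def)

lemma prime_contract:
  "prime_in B P \<Longrightarrow> A \<subseteq> B \<Longrightarrow> prime_in A (P \<inter> A)"
  unfolding prime_in_def ideal_in_def by (auto simp: zero_mem add_mem mult_mem subset_iff)

lemma pseudo_division:
  assumes "g \<in> polys_over A" "0 < degree g" "f \<in> polys_over A"
  obtains k q r where "q \<in> polys_over A" "r \<in> polys_over A"
    "smult (lead_coeff g ^ k) f = q * g + r" "degree r < degree g" "degree q \<le> degree f - degree g"
proof -
  let ?b = "lead_coeff g"
  have b: "?b \<in> A" using assms(1) by (simp add: polys_over_def)
  have "\<exists>k q r. q \<in> polys_over A \<and> r \<in> polys_over A \<and> smult (?b ^ k) f = q * g + r
      \<and> degree r < degree g \<and> degree q \<le> degree f - degree g"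
    using assms(3)
  proof (induction "degree f" arbitrary: f rule: less_induct)
    case less
    show ?case
    proof (cases "degree f < degree g")
      case True
      then show ?thesis using less.prems
        by (intro exI[of _ 0] exI[of _ 0] exI[of _ f]) (auto simp: polys_over_closed)
    next
      case False
      define m where "m = monom (lead_coeff f) (degree f - degree g)"
      have m: "m \<in> polys_over A" "degree m \<le> degree f - degree g"
        using less.prems unfolding m_def
        by (auto intro: degree_monom_le simp: polys_over_def zero_mem)
      have "degree (m * g) \<le> degree f"
        using degree_mult_le[of m g] m(2) False by simp
      moreover have "coeff (m * g) (degree f) = ?b * lead_coeff f"
        using False coeff_monom_mult[of "lead_coeff f" "degree f - degree g" g "degree f"]
        by (simp add: m_def mult.commute)
      ultimately have lower: "degree (smult ?b f - m * g) < degree f"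
        using m less.prems assms(1,2) b False
        by (intro remove_leading_term) (auto intro!: polys_over_closed degree_smult_le)
      have "smult ?b f - m * g \<in> polys_over A"
        using m less.prems assms(1) b by (auto intro!: polys_over_closed)
      from less.hyps[OF lower this] obtain k q r where IH: "q \<in> polys_over A" "r \<in> polys_over A"
        "smult (?b ^ k) (smult ?b f - m * g) = q * g + r" "degree r < degree g"
        "degree q \<le> degree (smult ?b f - m * g) - degree g" by blast
      have "smult (?b ^ Suc k) f = smult (?b ^ k) (smult ?b f - m * g) + smult (?b ^ k) (m * g)"
        by (simp add: smult_diff_right mult.commute)
      also have "\<dots> = (q + smult (?b ^ k) m) * g + r"
        unfolding IH(3) by (simp add: algebra_simps)
      finally have "smult (?b ^ Suc k) f = (q + smult (?b ^ k) m) * g + r" .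
      moreover have "degree (q + smult (?b ^ k) m) \<le> degree f - degree g"
        using IH(5) lower m(2) by (intro degree_add_le order_trans[OF degree_smult_le]) auto
      ultimately show ?thesis using IH(1,2,4) m(1) b
        by (intro exI[of _ "Suc k"] exI[of _ "q + smult (?b ^ k) m"] exI[of _ r])
          (auto intro!: polys_over_closed power_mem)
    qed
  qed
  then show ?thesis using that by blast
qed

lemma poly_in_ideal_adjoin:
  assumes "ideal_in (adjoin A x) P" "\<And>i. coeff f i \<in> P"
  shows "poly f x \<in> P"
proof -
  interpret B: ring_subset "adjoin A x" by (rule ring_subset_adjoin)
  have "x ^ i * coeff f i \<in> P" for i
    using assms by (intro ideal_mult[OF assms(1)]) (auto intro: B.power_mem adjoined_mem)
  then show ?thesis
    unfolding poly_altdef by (intro ideal_sum[OF assms(1)]) (simp add: mult.commute)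
qed

text \<open>
  Up to localisation the fibre is the spectrum of a ring generated by one element over a field,
  so its strict chains have at most two members. Concretely, an element of \<open>Q\<close> outside \<open>P\<close> is a
  relation for \<open>x\<close> modulo \<open>Q\<close>. If \<open>x\<close> were algebraic modulo \<open>P\<close> too, take a relation \<open>g\<close> modulo
  \<open>P\<close> of least degree and \<open>f\<close> of least degree with value in \<open>Q\<close> outside \<open>P\<close>. Division of \<open>g\<close> by
  \<open>f\<close> leaves a quotient and a remainder shorter than \<open>g\<close> with values in \<open>P\<close>. By minimality both
  vanish modulo \<open>P\<close>, and then so would the leading coefficient of \<open>g\<close>.
\<close>

lemma fibre_primes:
  assumes P: "prime_in (adjoin A x) P" and Q: "prime_in (adjoin A x) Q"
    and less: "P \<subset> Q" and eq: "P \<inter> A = Q \<inter> A"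
  shows "algebraic_mod A x Q" and "\<not> algebraic_mod A x P"
proof -
  let ?B = "adjoin A x"
  interpret B: ring_subset ?B by (rule ring_subset_adjoin)
  note iP = prime_ideal[OF P] and iQ = prime_ideal[OF Q]
  have cA: "coeff f i \<in> A" if "f \<in> polys_over A" for f i
    using that by (simp add: polys_over_def)
  obtain f0 where f0: "f0 \<in> polys_over A" "poly f0 x \<in> Q" "poly f0 x \<notin> P"
    using less ideal_sub[OF iQ] by (force simp: adjoin_def)
  then have "\<exists>i. coeff f0 i \<notin> P" using poly_in_ideal_adjoin[OF iP] by blast
  then show "algebraic_mod A x Q"
    using f0 cA eq unfolding algebraic_mod_def by blast
  show "\<not> algebraic_mod A x P"
  proof
    assume "algebraic_mod A x P"
    then obtain g0 where g0: "g0 \<in> polys_over A \<and> poly g0 x \<in> P \<and> (\<exists>i. coeff g0 i \<notin> P)"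
      by (auto simp: algebraic_mod_def)
    obtain g where g: "g \<in> polys_over A" "poly g x \<in> P" "\<exists>i. coeff g i \<notin> P"
      and g_min: "\<And>h. h \<in> polys_over A \<Longrightarrow> poly h x \<in> P \<Longrightarrow> degree h < degree g \<Longrightarrow> (\<forall>i. coeff h i \<in> P)"
      using ex_has_least_nat[of "\<lambda>g. g \<in> polys_over A \<and> poly g x \<in> P \<and> (\<exists>i. coeff g i \<notin> P)", OF g0, of degree]
      by (metis leD)
    obtain f where f: "f \<in> polys_over A" "poly f x \<in> Q" "poly f x \<notin> P"
      and f_min: "\<And>h. h \<in> polys_over A \<Longrightarrow> poly h x \<in> Q \<Longrightarrow> degree h < degree f \<Longrightarrow> poly h x \<in> P"
      using ex_has_least_nat[of "\<lambda>f. f \<in> polys_over A \<and> poly f x \<in> Q \<and> poly f x \<notin> P" f0 degree] f0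
      by (metis leD)
    \<comment> \<open>A constant \<open>f\<close> would lie in \<open>Q \<inter> A = P \<inter> A\<close>.\<close>
    have f_pos: "0 < degree f"
    proof (rule ccontr)
      assume "\<not> 0 < degree f"
      then obtain a where "f = [:a:]" by (metis degree_eq_zeroE neq0_conv)
      then show False using f eq cA[OF f(1), of 0] by auto
    qed
    have cut: "h - monom (lead_coeff h) (degree h) \<in> polys_over A"
      "0 < degree h \<Longrightarrow> degree (h - monom (lead_coeff h) (degree h)) < degree h"
      "lead_coeff h \<in> P \<Longrightarrow> poly (monom (lead_coeff h) (degree h)) x \<in> P"
      if "h \<in> polys_over A" for h
    proof -
      show "h - monom (lead_coeff h) (degree h) \<in> polys_over A"
        using that cA[OF that] by (auto intro!: polys_over_closed)
      show "degree (h - monom (lead_coeff h) (degree h)) < degree h" if "0 < degree h"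
        using \<open>h \<in> _\<close> cA[OF \<open>h \<in> _\<close>] that
        by (intro remove_leading_term) (auto intro: polys_over_closed degree_monom_le)
      show "poly (monom (lead_coeff h) (degree h)) x \<in> P" if "lead_coeff h \<in> P"
        using that by (intro poly_in_ideal_adjoin[OF iP]) (auto simp: ideal_zero[OF iP])
    qed
    \<comment> \<open>A leading term with coefficient in \<open>P\<close> could be dropped, against minimality.\<close>
    have lf: "lead_coeff f \<notin> P"
    proof
      assume l: "lead_coeff f \<in> P"
      let ?h = "f - monom (lead_coeff f) (degree f)"
      have "poly ?h x \<in> Q" "poly f x = poly ?h x + poly (monom (lead_coeff f) (degree f)) x"
        using f(2) cut(3)[OF f(1) l] less by (auto intro!: B.ideal_diff[OF iQ])
      then show False
        using f_min[of ?h] cut(1)[OF f(1)] cut(2)[OF f(1) f_pos] f(3) cut(3)[OF f(1) l]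
          ideal_add[OF iP] by metis
    qed
    have lfA: "lead_coeff f \<in> A" "lead_coeff g \<in> A" using cA f(1) g(1) by auto
    have lg: "lead_coeff g \<notin> P"
    proof
      assume l: "lead_coeff g \<in> P"
      let ?m = "monom (lead_coeff g) (degree g)"
      have m: "poly (g - ?m) x \<in> P"
        using g(2) cut(3)[OF g(1) l] by (auto intro!: B.ideal_diff[OF iP])
      obtain i where i: "coeff g i \<notin> P" using g(3) by blast
      then have "i \<noteq> degree g" "i \<le> degree g" using l ideal_zero[OF iP] by (auto intro: le_degree)
      then have "0 < degree g" "coeff (g - ?m) i = coeff g i" by auto
      then show False
        using g_min[of "g - ?m"] cut(1,2)[OF g(1)] m i by metis
    qed
    \<comment> \<open>Otherwise one step of division by \<open>g\<close> would lower the degree of \<open>f\<close>.\<close>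
    have shorter: "degree f < degree g"
    proof (rule ccontr)
      assume "\<not> degree f < degree g"
      then have le: "degree g \<le> degree f" by simp
      define m where "m = monom (lead_coeff f) (degree f - degree g)"
      have m: "m \<in> polys_over A" "degree m \<le> degree f - degree g"
        using lfA unfolding m_def by (auto intro: polys_over_closed degree_monom_le)
      have "degree (m * g) \<le> degree f"
        using degree_mult_le[of m g] m(2) le by simp
      moreover have "coeff (m * g) (degree f) = lead_coeff g * lead_coeff f"
        using le coeff_monom_mult[of "lead_coeff f" "degree f - degree g" g "degree f"]
        by (simp add: m_def mult.commute)
      ultimately have lower: "degree (smult (lead_coeff g) f - m * g) < degree f"
        using m f g lfA f_pos
        by (intro remove_leading_term) (auto intro!: polys_over_closed degree_smult_le)
      have mg: "poly m x * poly g x \<in> P"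
        using m(1) g(2) by (intro ideal_mult[OF iP] poly_mem_adjoin)
      then have "poly m x * poly g x \<in> Q" using less by blast
      then have "poly (smult (lead_coeff g) f - m * g) x \<in> Q"
        unfolding poly_diff poly_smult poly_mult
        by (rule B.ideal_diff[OF iQ ideal_mult[OF iQ mem_adjoin[OF lfA(2)] f(2)]])
      then have "poly (smult (lead_coeff g) f - m * g) x \<in> P"
        using m f g lfA lower by (intro f_min) (auto intro!: polys_over_closed)
      then have "lead_coeff g * poly f x \<in> P"
        using ideal_add[OF iP _ mg] by fastforce
      then show False
        using prime_mult_iff[OF P mem_adjoin[OF lfA(2)] poly_mem_adjoin[OF f(1)]] lg f(3) by blast
    qed
    \<comment> \<open>The remainder has its value in \<open>Q\<close> and degree below \<open>f\<close>, hence value in \<open>P\<close>; then so has the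
      quotient, as \<open>P\<close> is prime. Both are shorter than \<open>g\<close>, so all their coefficients are in \<open>P\<close>.\<close>
    from pseudo_division[OF f(1) f_pos g(1)] obtain k q r where
      d: "q \<in> polys_over A" "r \<in> polys_over A" "smult (lead_coeff f ^ k) g = q * f + r"
      "degree r < degree f" "degree q \<le> degree g - degree f" .
    have ev: "lead_coeff f ^ k * poly g x = poly q x * poly f x + poly r x"
      using arg_cong[OF d(3), of "\<lambda>p. poly p x"] by simp
    have lfk: "lead_coeff f ^ k \<in> A" using lfA(1) by (rule power_mem)
    have cg: "lead_coeff f ^ k * poly g x \<in> P"
      using lfk g(2) by (intro ideal_mult[OF iP] mem_adjoin)
    have "poly r x = lead_coeff f ^ k * poly g x - poly q x * poly f x"
      using ev by simp
    moreover have "poly q x * poly f x \<in> Q"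
      by (rule ideal_mult[OF iQ poly_mem_adjoin[OF d(1)] f(2)])
    moreover have "lead_coeff f ^ k * poly g x \<in> Q" using cg less by blast
    ultimately have "poly r x \<in> Q" using B.ideal_diff[OF iQ] by simp
    then have rP: "poly r x \<in> P" using f_min d(2,4) by blast
    have "poly q x * poly f x = lead_coeff f ^ k * poly g x - poly r x"
      using ev by simp
    then have "poly q x * poly f x \<in> P"
      using B.ideal_diff[OF iP cg rP] by simp
    then have qP: "poly q x \<in> P"
      using prime_mult_iff[OF P] poly_mem_adjoin d(1) f(1,3) by blast
    have "degree r < degree g" "degree q < degree g" using d(4,5) f_pos shorter by auto
    then have "coeff r i \<in> P" "coeff q i \<in> P" for i
      using g_min d(1,2) rP qP by auto
    note qr = this
    have "coeff q j * coeff f i \<in> P" for i j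
      using ideal_mult[OF iP mem_adjoin[OF cA[OF f(1)]] qr(2)] by (simp add: mult.commute)
    then have "coeff (q * f + r) i \<in> P" for i
      unfolding coeff_add coeff_mult using qr(1)
      by (intro ideal_add[OF iP] ideal_sum[OF iP])
    then have "coeff (smult (lead_coeff f ^ k) g) (degree g) \<in> P" using d(3) by simp
    then have "lead_coeff f ^ k * lead_coeff g \<in> P" by simp
    then show False
      using prime_mult_iff[OF P] B.prime_power_notin[OF P _ lf] lg lfk lfA mem_adjoin by blast
  qed
qed

text \<open>
  Along a chain of primes of \<open>A[x]\<close> each contraction to \<open>A\<close> occurs at most twice, first with \<open>x\<close>
  transcendental, then with \<open>x\<close> algebraic. Doubling makes a drop of the contracted rank outweigh the
  extra unit, which may jump back up.
\<close>

theorem strict_prime_rank_adjoin: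
  assumes "strict_prime_rank A \<phi> b"
  shows "strict_prime_rank (adjoin A x)
    (\<lambda>P. 2 * \<phi> (P \<inter> A) + (if algebraic_mod A x P then 0 else 1)) (2 * b + 1)"
  unfolding strict_prime_rank_def
proof (intro conjI allI impI)
  have sub: "A \<subseteq> adjoin A x" using mem_adjoin by blast
  note contr = prime_contract[OF _ sub]
  fix P assume P: "prime_in (adjoin A x) P"
  have "\<phi> (P \<inter> A) \<le> b"
    using assms contr[OF P] by (auto simp: strict_prime_rank_def)
  then show "2 * \<phi> (P \<inter> A) + (if algebraic_mod A x P then 0 else 1) \<le> 2 * b + 1" by simp
  fix Q assume Q: "prime_in (adjoin A x) Q" and less: "P \<subset> Q"
  show "2 * \<phi> (Q \<inter> A) + (if algebraic_mod A x Q then 0 else 1)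
      < 2 * \<phi> (P \<inter> A) + (if algebraic_mod A x P then 0 else 1)"
  proof (cases "P \<inter> A = Q \<inter> A")
    case True
    then show ?thesis using fibre_primes[OF P Q less] by simp
  next
    case False
    then have "\<phi> (Q \<inter> A) < \<phi> (P \<inter> A)"
      using assms contr[OF P] contr[OF Q] less unfolding strict_prime_rank_def by blast
    then show ?thesis by simp
  qed
qed

end

text \<open>
  Read \<open>\<F>\<close> as a base of neighbourhoods. An ideal \<open>P\<close> maximal subject to lying below some member of
  every neighbourhood is prime: if \<open>a\<close> and \<open>b\<close> are outside \<open>P\<close>, each is avoided by all primes above
  \<open>P\<close> in some neighbourhood, and a smaller neighbourhood contains a prime avoiding both, hence also
  \<open>a * b\<close>. The last clause says that \<open>P\<close> contains everything that lies in primes above it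
  arbitrarily close to the limit.
\<close>

lemma prime_limit:
  assumes "ring_subset A" "ideal_chains_stabilise A"
    and ne: "\<F> \<noteq> {}"
    and prime: "\<And>F Q. F \<in> \<F> \<Longrightarrow> Q \<in> F \<Longrightarrow> prime_in A Q"
    and inhabited: "\<And>F. F \<in> \<F> \<Longrightarrow> F \<noteq> {}"
    and directed: "\<And>F F'. F \<in> \<F> \<Longrightarrow> F' \<in> \<F> \<Longrightarrow> \<exists>E\<in>\<F>. E \<subseteq> F \<inter> F'"
  obtains P where "prime_in A P" "\<forall>F\<in>\<F>. \<exists>Q\<in>F. P \<subseteq> Q"
    "\<forall>f\<in>A - P. \<exists>F\<in>\<F>. \<forall>Q\<in>F. P \<subseteq> Q \<longrightarrow> f \<notin> Q"
proof -
  interpret ring_subset A by fact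
  define C where "C = (\<lambda>J. \<forall>F\<in>\<F>. \<exists>Q\<in>F. J \<subseteq> Q)"
  have "ideal_in A {0}" by (auto simp: ideal_in_def zero_mem)
  moreover have "C {0}"
    unfolding C_def using inhabited prime ideal_zero[OF prime_ideal] by fast
  ultimately obtain P where P: "ideal_in A P" "C P"
    and max: "\<And>J. ideal_in A J \<Longrightarrow> C J \<Longrightarrow> P \<subseteq> J \<Longrightarrow> J = P"
    using maximal_ideal_with[OF assms(2)] by metis
  have avoid: "\<exists>F\<in>\<F>. \<forall>Q\<in>F. P \<subseteq> Q \<longrightarrow> f \<notin> Q" if f: "f \<in> A" "f \<notin> P" for f
  proof -
    define J where "J = {a + r * f | a r. a \<in> P \<and> r \<in> A}"
    note J = ideal_plus_principal[OF P(1) f(1), folded J_def]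
    have "\<not> C J" using max[OF J(1) _ J(2)] J(3) f(2) by metis
    then obtain F where F: "F \<in> \<F>" "\<And>Q. Q \<in> F \<Longrightarrow> \<not> J \<subseteq> Q" by (auto simp: C_def)
    have "f \<notin> Q" if Q: "Q \<in> F" "P \<subseteq> Q" for Q
    proof
      assume "f \<in> Q"
      note iQ = prime_ideal[OF prime[OF F(1) Q(1)]]
      have "a + r * f \<in> Q" if "a \<in> P" "r \<in> A" for a r
        using that Q(2) \<open>f \<in> Q\<close> by (intro ideal_add[OF iQ] ideal_mult[OF iQ]) auto
      then have "J \<subseteq> Q" by (auto simp: J_def)
      then show False using F(2)[OF Q(1)] by simp
    qed
    then show ?thesis using F(1) by (intro bexI[of _ F]) simp_all
  qed
  have "prime_in A P"
    unfolding prime_in_def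
  proof (intro conjI ballI impI)
    show "ideal_in A P" by fact
    obtain F where "F \<in> \<F>" using ne by blast
    moreover obtain Q where "Q \<in> F" "P \<subseteq> Q" using P(2) \<open>F \<in> \<F>\<close> by (auto simp: C_def)
    ultimately have "prime_in A Q" "P \<subseteq> Q" using prime by auto
    then show "1 \<notin> P" by (auto simp: prime_in_def)
    fix a b assume ab: "a \<in> A" "b \<in> A" "a * b \<in> P"
    show "a \<in> P \<or> b \<in> P"
    proof (rule ccontr)
      assume "\<not> (a \<in> P \<or> b \<in> P)"
      then have nP: "a \<notin> P" "b \<notin> P" by auto
      obtain F where F: "F \<in> \<F>" "\<And>Q. Q \<in> F \<Longrightarrow> P \<subseteq> Q \<Longrightarrow> a \<notin> Q"
        using avoid[OF ab(1) nP(1)] by auto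
      obtain F' where F': "F' \<in> \<F>" "\<And>Q. Q \<in> F' \<Longrightarrow> P \<subseteq> Q \<Longrightarrow> b \<notin> Q"
        using avoid[OF ab(2) nP(2)] by auto
      obtain E where E: "E \<in> \<F>" "E \<subseteq> F \<inter> F'" using directed[OF F(1) F'(1)] by auto
      then obtain Q where Q: "Q \<in> E" "P \<subseteq> Q" using P(2) by (auto simp: C_def)
      then have "a \<in> Q \<or> b \<in> Q"
        using ab prime_mult_iff[OF prime[OF E(1) Q(1)] ab(1,2)] by auto
      then show False using F(2)[of Q] F'(2)[of Q] E(2) Q by auto
    qed
  qed
  moreover have "\<forall>F\<in>\<F>. \<exists>Q\<in>F. P \<subseteq> Q" using P(2) by (simp add: C_def)
  moreover have "\<forall>f\<in>A - P. \<exists>F\<in>\<F>. \<forall>Q\<in>F. P \<subseteq> Q \<longrightarrow> f \<notin> Q" using avoid by simp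
  ultimately show ?thesis by (rule that)
qed

section \<open>The space of quantifier-free types\<close>

lemma tval_cong: "(\<And>i. i \<in> tvars t \<Longrightarrow> e i = e' i) \<Longrightarrow> tval M e t = tval M e' t"
  by (induction t) auto

lemma sat_cong: "(\<And>i. i \<in> fvars f \<Longrightarrow> e i = e' i) \<Longrightarrow> sat M e f \<longleftrightarrow> sat M e' f"
proof (induction f arbitrary: e e')
  case (FEq s t)
  then show ?case using tval_cong[of s e e' M] tval_cong[of t e e' M] by simp
next
  case (FConj f g)
  from FConj.IH(1)[of e e'] FConj.IH(2)[of e e'] FConj.prems show ?case by simp
next
  case (FAll i f)
  have "sat M (e(i := a)) f \<longleftrightarrow> sat M (e'(i := a)) f" for a
    by (rule FAll.IH) (use FAll.prems in auto)
  then show ?case by simp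
next
  case (FNeg f)
  from FNeg.IH[of e e'] FNeg.prems show ?case by simp
qed

text \<open>
  Completeness makes the formulas true at a realising tuple the entire type, so that membership can be
  computed as satisfaction.
\<close>

lemma qf_typesE:
  assumes "p \<in> qf_types T n"
  obtains M :: "nat monoid" and as
  where "model T M" "length as = n" "set as \<subseteq> carrier M" "p = qf_type M as"
proof -
  from assms obtain M :: "nat monoid" and as where M: "model T M" "length as = n" "set as \<subseteq> carrier M"
    and p: "p \<subseteq> qf_formulas n" "\<And>f. f \<in> qf_formulas n \<Longrightarrow> f \<in> p \<or> FNeg f \<in> p"
      "\<And>f. f \<in> p \<Longrightarrow> sat M (nth as) f"
    by (auto simp: qf_types_def)
  have "f \<in> p" if "f \<in> qf_formulas n" "sat M (nth as) f" for f
    using p(2)[OF that(1)] p(3)[of "FNeg f"] that(2) by auto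
  then have "p = qf_type M as"
    using M(2) p(1,3) by (auto simp: qf_type_def)
  with M show ?thesis by (rule that)
qed

lemma qf_types_formulas: "p \<in> qf_types T n \<Longrightarrow> f \<in> p \<Longrightarrow> f \<in> qf_formulas n"
  by (auto simp: qf_types_def)

lemma conj_in_qf_type:
  "p \<in> qf_types T n \<Longrightarrow> FConj f g \<in> p \<longleftrightarrow> f \<in> p \<and> g \<in> p"
  by (elim qf_typesE) (auto simp: qf_type_def qf_formulas_def)

lemma true_in_qf_type: "p \<in> qf_types T n \<Longrightarrow> FEq TOne TOne \<in> p"
  by (elim qf_typesE) (auto simp: qf_type_def qf_formulas_def)

text \<open>
  Quantifier-free formulas are Boolean combinations of equations.
\<close>

lemma qf_type_eqI:
  assumes p: "p \<in> qf_types T n" and q: "q \<in> qf_types T n"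
    and atoms: "\<And>s t. tvars s \<subseteq> {..<n} \<Longrightarrow> tvars t \<subseteq> {..<n} \<Longrightarrow> FEq s t \<in> p \<longleftrightarrow> FEq s t \<in> q"
  shows "p = q"
proof -
  obtain M :: "nat monoid" and as where M: "length as = n" "p = qf_type M as"
    using p by (rule qf_typesE)
  obtain N :: "nat monoid" and bs where N: "length bs = n" "q = qf_type N bs"
    using q by (rule qf_typesE)
  have "sat M (nth as) f \<longleftrightarrow> sat N (nth bs) f" if "qfree f" "fvars f \<subseteq> {..<n}" for f
    using that
  proof (induction f)
    case (FEq s t)
    then show ?case using atoms[of s t] M N by (auto simp: qf_type_def qf_formulas_def)
  qed auto
  then show ?thesis using M N by (auto simp: qf_type_def qf_formulas_def)
qed

lemma topspace_qf_type_space: "topspace (qf_type_space T n) = qf_types T n"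
  using true_in_qf_type[of _ T n] qf_types_formulas[of _ T n]
  by (fastforce simp: qf_type_space_def)

lemma openin_basic: "f \<in> qf_formulas n \<Longrightarrow> openin (qf_type_space T n) {p \<in> qf_types T n. f \<in> p}"
  unfolding qf_type_space_def by (intro topology_generated_by_Basis imageI)

text \<open>
  The generating sets are closed under finite intersections because formulas are closed under
  conjunction, so they form a base and not only a subbase.
\<close>

lemma basic_neighbourhood:
  assumes "openin (qf_type_space T n) U" "p \<in> U"
  obtains f where "f \<in> p" "{q \<in> qf_types T n. f \<in> q} \<subseteq> U"
proof -
  have pS: "p \<in> qf_types T n"
    using assms openin_subset[of "qf_type_space T n" U] by (auto simp: topspace_qf_type_space)
  have "generate_topology_on ((\<lambda>f. {p \<in> qf_types T n. f \<in> p}) ` qf_formulas n) U"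
    using assms(1) unfolding qf_type_space_def by (rule openin_topology_generated_by)
  then have "p \<in> U \<Longrightarrow> \<exists>f\<in>p. {q \<in> qf_types T n. f \<in> q} \<subseteq> U"
  proof induction
    case (Int a b)
    then obtain f g where "f \<in> p" "g \<in> p" "{q \<in> qf_types T n. f \<in> q} \<subseteq> a" "{q \<in> qf_types T n. g \<in> q} \<subseteq> b"
      by auto
    then show ?case using conj_in_qf_type[of _ T n f g] pS
      by (intro bexI[of _ "FConj f g"]) auto
  next
    case (UN K)
    then show ?case by blast
  qed auto
  then obtain f where "f \<in> p" "{q \<in> qf_types T n. f \<in> q} \<subseteq> U" using assms(2) by auto
  then show ?thesis by (rule that)
qed

lemma non_isolated_qf_type_iff:
  assumes "A \<subseteq> qf_types T n"
  shows "p \<in> non_isolated (qf_type_space T n) A \<longleftrightarrow> p \<in> A \<and> (\<forall>f\<in>p. \<exists>q\<in>A. f \<in> q \<and> q \<noteq> p)"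
proof -
  have "openin (subtopology (qf_type_space T n) A) {p} \<longleftrightarrow> (\<exists>f\<in>p. \<forall>q\<in>A. f \<in> q \<longrightarrow> q = p)" if p: "p \<in> A"
  proof
    assume "openin (subtopology (qf_type_space T n) A) {p}"
    then obtain U where U: "openin (qf_type_space T n) U" "{p} = U \<inter> A"
      by (auto simp: openin_subtopology)
    then obtain f where f: "f \<in> p" "{q \<in> qf_types T n. f \<in> q} \<subseteq> U"
      using basic_neighbourhood[OF U(1), of p] by auto
    have "q = p" if "q \<in> A" "f \<in> q" for q
    proof -
      have "q \<in> U \<inter> A" using that f(2) assms by auto
      then show ?thesis using U(2) by auto
    qed
    then show "\<exists>f\<in>p. \<forall>q\<in>A. f \<in> q \<longrightarrow> q = p" using f(1) by auto
  next
    assume "\<exists>f\<in>p. \<forall>q\<in>A. f \<in> q \<longrightarrow> q = p"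
    then obtain f where f: "f \<in> p" "\<And>q. q \<in> A \<Longrightarrow> f \<in> q \<Longrightarrow> q = p" by blast
    have "f \<in> qf_formulas n" by (rule qf_types_formulas[OF subsetD[OF assms p] f(1)])
    have "x \<in> {p} \<longleftrightarrow> x \<in> {q \<in> qf_types T n. f \<in> q} \<inter> A" for x
      using f(1) f(2)[of x] p subsetD[OF assms, of x] by blast
    then have "{p} = {q \<in> qf_types T n. f \<in> q} \<inter> A" by (rule Set.set_eqI)
    with openin_basic[OF \<open>f \<in> qf_formulas n\<close>, of T]
    show "openin (subtopology (qf_type_space T n) A) {p}"
      unfolding openin_subtopology by (intro exI conjI)
  qed
  then show ?thesis by (auto simp: non_isolated_def)
qed

lemma cb_derivative_0_qf: "cb_derivative (qf_type_space T n) (0::nat) = qf_types T n"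
  by (simp add: cb_derivative_zero topspace_qf_type_space)

lemma cb_derivative_Suc: "cb_derivative S (Suc d) = non_isolated S (cb_derivative S d)"
  by (rule cb_derivative_succ) auto

lemma cb_derivative_qf_types: "cb_derivative (qf_type_space T n) (d::nat) \<subseteq> qf_types T n"
  using cb_derivative_antimono[of 0 d "qf_type_space T n"] by (simp add: cb_derivative_0_qf)

section \<open>Independence of the generating tuple\<close>

primrec tsubst :: "(nat \<Rightarrow> gterm) \<Rightarrow> gterm \<Rightarrow> gterm" where
  "tsubst \<sigma> (TVar i) = \<sigma> i"
| "tsubst \<sigma> TOne = TOne"
| "tsubst \<sigma> (TInv t) = TInv (tsubst \<sigma> t)"
| "tsubst \<sigma> (TMult s t) = TMult (tsubst \<sigma> s) (tsubst \<sigma> t)"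

text \<open>
  Only quantifier-free formulas are substituted into, so capture of variables does not arise.
\<close>

primrec fsubst :: "(nat \<Rightarrow> gterm) \<Rightarrow> gformula \<Rightarrow> gformula" where
  "fsubst \<sigma> (FEq s t) = FEq (tsubst \<sigma> s) (tsubst \<sigma> t)"
| "fsubst \<sigma> (FNeg f) = FNeg (fsubst \<sigma> f)"
| "fsubst \<sigma> (FConj f g) = FConj (fsubst \<sigma> f) (fsubst \<sigma> g)"
| "fsubst \<sigma> (FAll i f) = FAll i f"

lemma tval_tsubst: "tval M e (tsubst \<sigma> t) = tval M (\<lambda>i. tval M e (\<sigma> i)) t"
  by (induction t) auto

lemma sat_fsubst: "qfree f \<Longrightarrow> sat M e (fsubst \<sigma> f) \<longleftrightarrow> sat M (\<lambda>i. tval M e (\<sigma> i)) f"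
  by (induction f) (auto simp: tval_tsubst)

lemma tvars_tsubst: "tvars (tsubst \<sigma> t) = (\<Union>i\<in>tvars t. tvars (\<sigma> i))"
  by (induction t) auto

lemma qf_formulas_fsubst:
  assumes "\<And>i. i < m \<Longrightarrow> tvars (\<sigma> i) \<subseteq> {..<n}" "f \<in> qf_formulas m"
  shows "fsubst \<sigma> f \<in> qf_formulas n"
proof -
  have "qfree (fsubst \<sigma> f) \<and> fvars (fsubst \<sigma> f) \<subseteq> {..<n}" if "qfree f" "fvars f \<subseteq> {..<m}"
    using that assms(1) by (induction f) (fastforce simp: tvars_tsubst)+
  then show ?thesis using assms(2) by (simp add: qf_formulas_def)
qed

text \<open>
  The map on types induced by the map of tuples that sends \<open>as\<close> to the values of the words \<open>\<sigma>\<close> at \<open>as\<close>.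
\<close>

definition pull_back :: "(nat \<Rightarrow> gterm) \<Rightarrow> nat \<Rightarrow> gformula set \<Rightarrow> gformula set" where
  "pull_back \<sigma> m p = {f \<in> qf_formulas m. fsubst \<sigma> f \<in> p}"

lemma pull_back_qf_type:
  assumes "\<And>j. j < m \<Longrightarrow> tvars (\<sigma> j) \<subseteq> {..<length as}"
    and "length bs = m" "\<And>j. j < m \<Longrightarrow> bs ! j = tval M (nth as) (\<sigma> j)"
  shows "pull_back \<sigma> m (qf_type M as) = qf_type M bs"
proof -
  have "sat M (nth as) (fsubst \<sigma> f) \<longleftrightarrow> sat M (nth bs) f" if f: "f \<in> qf_formulas m" for f
    unfolding sat_fsubst[OF f[unfolded qf_formulas_def, simplified, THEN conjunct1]]
    by (rule sat_cong) (use f assms(3) in \<open>auto simp: qf_formulas_def\<close>)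
  then show ?thesis
    using assms(2) qf_formulas_fsubst[of m \<sigma> "length as", OF assms(1)]
    by (auto simp: pull_back_def qf_type_def)
qed

text \<open>
  The formula expressing that \<open>\<tau>\<close> recovers a tuple from the values of \<open>\<sigma>\<close> at it. It cuts out the clopen
  set of types on which pulling back along \<open>\<sigma>\<close> is injective.
\<close>

definition mutually_inverse :: "(nat \<Rightarrow> gterm) \<Rightarrow> (nat \<Rightarrow> gterm) \<Rightarrow> nat \<Rightarrow> gformula" where
  "mutually_inverse \<sigma> \<tau> n =
     foldr FConj (map (\<lambda>i. FEq (TVar i) (tsubst \<sigma> (\<tau> i))) [0..<n]) (FEq TOne TOne)"

lemma sat_mutually_inverse:
  "sat M e (mutually_inverse \<sigma> \<tau> n) \<longleftrightarrow> (\<forall>i<n. e i = tval M (\<lambda>j. tval M e (\<sigma> j)) (\<tau> i))"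
proof -
  have "sat M e (foldr FConj fs (FEq TOne TOne)) \<longleftrightarrow> (\<forall>f\<in>set fs. sat M e f)" for fs
    by (induction fs) auto
  then show ?thesis by (auto simp: mutually_inverse_def tval_tsubst)
qed

lemma mutually_inverse_formula:
  assumes "\<And>j. j < m \<Longrightarrow> tvars (\<sigma> j) \<subseteq> {..<n}" "\<And>i. i < n \<Longrightarrow> tvars (\<tau> i) \<subseteq> {..<m}"
  shows "mutually_inverse \<sigma> \<tau> n \<in> qf_formulas n"
proof -
  have "foldr FConj fs (FEq TOne TOne) \<in> qf_formulas n" if "set fs \<subseteq> qf_formulas n" for fs
    using that by (induction fs) (auto simp: qf_formulas_def)
  moreover have "FEq (TVar i) (tsubst \<sigma> (\<tau> i)) \<in> qf_formulas n" if "i < n" for i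
    using that assms(1) assms(2)[OF that] by (fastforce simp: qf_formulas_def tvars_tsubst)
  ultimately show ?thesis unfolding mutually_inverse_def by (simp add: image_subset_iff)
qed

text \<open>
  Pulling back is a homeomorphism between clopen sets, and the derivatives are local. For the proof
  by induction on \<open>d\<close> it suffices that a type \<open>q \<noteq> p\<close> near \<open>p\<close> also satisfies \<open>mutually_inverse \<sigma> \<tau> n\<close>, so that its
  image is near the image of \<open>p\<close> and different from it.
\<close>

lemma cb_derivative_pull_back:
  assumes univ: "\<And>f. f \<in> T \<Longrightarrow> universal_sentence f"
    and \<sigma>: "\<And>j. j < m \<Longrightarrow> tvars (\<sigma> j) \<subseteq> {..<n}" and \<tau>: "\<And>i. i < n \<Longrightarrow> tvars (\<tau> i) \<subseteq> {..<m}"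
  shows "p \<in> cb_derivative (qf_type_space T n) (d::nat) \<Longrightarrow> mutually_inverse \<sigma> \<tau> n \<in> p
    \<Longrightarrow> pull_back \<sigma> m p \<in> cb_derivative (qf_type_space T m) d"
proof (induction d arbitrary: p)
  have realise: "\<exists>(M :: nat monoid) as bs. model T M \<and> length as = n \<and> set as \<subseteq> carrier M \<and> p = qf_type M as
      \<and> length bs = m \<and> set bs \<subseteq> carrier M \<and> pull_back \<sigma> m p = qf_type M bs
      \<and> (\<forall>j<m. bs ! j = tval M (nth as) (\<sigma> j))" if p: "p \<in> qf_types T n" for p
  proof -
    obtain M :: "nat monoid" and as
      where M: "model T M" "length as = n" "set as \<subseteq> carrier M" "p = qf_type M as"
      using p by (rule qf_typesE)
    define bs where "bs = map (\<lambda>j. tval M (nth as) (\<sigma> j)) [0..<m]"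
    have "tval M (nth as) (\<sigma> j) \<in> carrier M" if "j < m" for j
    proof (rule tval_closed)
      show "group M" using M(1) by (simp add: model_def)
      show "as ! i \<in> carrier M" if "i \<in> tvars (\<sigma> j)" for i
      proof -
        have "i < length as" using that \<sigma>[OF \<open>j < m\<close>] M(2) by auto
        then show ?thesis using M(3) nth_mem by blast
      qed
    qed
    then have "set bs \<subseteq> carrier M" by (auto simp: bs_def)
    moreover have "pull_back \<sigma> m (qf_type M as) = qf_type M bs"
      using M(2) \<sigma> by (intro pull_back_qf_type) (auto simp: bs_def)
    moreover have "\<forall>j<m. bs ! j = tval M (nth as) (\<sigma> j)" "length bs = m" by (auto simp: bs_def)
    ultimately show ?thesis using M by blast
  qed
  {
    case 0
    then obtain M :: "nat monoid" and bs
      where "model T M" "length bs = m" "set bs \<subseteq> carrier M" "pull_back \<sigma> m p = qf_type M bs"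
      using realise[of p] by (auto simp: cb_derivative_0_qf)
    then show ?case using qf_type_in_qf_types[of T M bs] univ by (auto simp: cb_derivative_0_qf)
  next
    case (Suc d)
    let ?D = "\<lambda>n. cb_derivative (qf_type_space T n) d"
    have inverse: "pull_back \<tau> n (pull_back \<sigma> m q) = q"
      if q: "q \<in> qf_types T n" "mutually_inverse \<sigma> \<tau> n \<in> q" for q
    proof -
      from realise[OF q(1)] obtain M :: "nat monoid" and as bs where M: "length as = n" "q = qf_type M as"
        "length bs = m" "pull_back \<sigma> m q = qf_type M bs" "\<forall>j<m. bs ! j = tval M (nth as) (\<sigma> j)"
        by blast
      have "as ! i = tval M (nth bs) (\<tau> i)" if i: "i < n" for i
      proof -
        have "as ! i = tval M (\<lambda>j. tval M (nth as) (\<sigma> j)) (\<tau> i)"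
          using q(2) i M(2) by (auto simp: qf_type_def sat_mutually_inverse)
        also have "\<dots> = tval M (nth bs) (\<tau> i)"
          using \<tau>[OF i] M(5) by (intro tval_cong) auto
        finally show ?thesis .
      qed
      then have "pull_back \<tau> n (qf_type M bs) = qf_type M as"
        using \<tau> M(1,3) by (intro pull_back_qf_type) auto
      then show ?thesis using M(2,4) by simp
    qed
    have p: "p \<in> ?D n" "\<And>f. f \<in> p \<Longrightarrow> \<exists>q\<in>?D n. f \<in> q \<and> q \<noteq> p"
      using Suc.prems(1) unfolding cb_derivative_Suc non_isolated_qf_type_iff[OF cb_derivative_qf_types]
      by blast+
    have pS: "p \<in> qf_types T n" using p(1) cb_derivative_qf_types by blast
    show ?case
      unfolding cb_derivative_Suc non_isolated_qf_type_iff[OF cb_derivative_qf_types]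
    proof (intro conjI ballI)
      show "pull_back \<sigma> m p \<in> ?D m" by (rule Suc.IH[OF p(1) Suc.prems(2)])
      fix f assume f: "f \<in> pull_back \<sigma> m p"
      then have "FConj (fsubst \<sigma> f) (mutually_inverse \<sigma> \<tau> n) \<in> p"
        using Suc.prems(2) conj_in_qf_type[OF pS] by (simp add: pull_back_def)
      then obtain q where q: "q \<in> ?D n" "FConj (fsubst \<sigma> f) (mutually_inverse \<sigma> \<tau> n) \<in> q" "q \<noteq> p"
        using p(2) by blast
      have qS: "q \<in> qf_types T n" using q(1) cb_derivative_qf_types by blast
      have q': "fsubst \<sigma> f \<in> q" "mutually_inverse \<sigma> \<tau> n \<in> q"
        using q(2) conj_in_qf_type[OF qS] by auto
      have "pull_back \<sigma> m q \<noteq> pull_back \<sigma> m p"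
        using inverse[OF qS q'(2)] inverse[OF pS Suc.prems(2)] q(3) by metis
      moreover have "f \<in> pull_back \<sigma> m q" using q'(1) f by (simp add: pull_back_def)
      moreover have "pull_back \<sigma> m q \<in> ?D m" by (rule Suc.IH[OF q(1) q'(2)])
      ultimately show "\<exists>q\<in>?D m. f \<in> q \<and> q \<noteq> pull_back \<sigma> m p" by blast
    qed
  }
qed

text \<open>
  The bound on the variables is what makes these words eligible for substitution into formulas in
  finitely many variables.
\<close>

lemma generate_bounded_term:
  assumes "x \<in> generate M (set as)"
  shows "\<exists>t. tvars t \<subseteq> {..<length as} \<and> x = tval M (nth as) t"
  using assms
proof induction
  case one
  show ?case by (rule exI[of _ TOne]) simp
next
  case (incl h)
  then obtain i where "i < length as" "h = as ! i" by (metis in_set_conv_nth)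
  then show ?case by (intro exI[of _ "TVar i"]) simp
next
  case (inv h)
  then obtain i where "i < length as" "h = as ! i" by (metis in_set_conv_nth)
  then show ?case by (intro exI[of _ "TInv (TVar i)"]) simp
next
  case (eng h1 h2)
  then obtain s t where "tvars s \<subseteq> {..<length as}" "h1 = tval M (nth as) s"
    "tvars t \<subseteq> {..<length as}" "h2 = tval M (nth as) t" by blast
  then show ?case by (intro exI[of _ "TMult s t"]) simp
qed

lemma generating_tuple_terms:
  assumes "generating_tuple M as" "set bs \<subseteq> carrier M"
  obtains \<sigma> where "\<And>j. j < length bs \<Longrightarrow> tvars (\<sigma> j) \<subseteq> {..<length as}"
    "\<And>j. j < length bs \<Longrightarrow> bs ! j = tval M (nth as) (\<sigma> j)"
proof -
  have "\<exists>t. tvars t \<subseteq> {..<length as} \<and> bs ! j = tval M (nth as) t" if "j < length bs" for j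
    using assms that by (intro generate_bounded_term) (auto simp: generating_tuple_def)
  then show ?thesis using that by metis
qed

theorem cb_derivative_generating_tuple:
  assumes univ: "\<And>f. f \<in> T \<Longrightarrow> universal_sentence f"
    and as: "generating_tuple M as" and bs: "generating_tuple M bs"
    and d: "qf_type M as \<in> cb_derivative (qf_type_space T (length as)) (d::nat)"
  shows "qf_type M bs \<in> cb_derivative (qf_type_space T (length bs)) d"
proof -
  obtain \<sigma> where \<sigma>: "\<And>j. j < length bs \<Longrightarrow> tvars (\<sigma> j) \<subseteq> {..<length as}"
    "\<And>j. j < length bs \<Longrightarrow> bs ! j = tval M (nth as) (\<sigma> j)"
    using generating_tuple_terms[OF as] bs by (auto simp: generating_tuple_def)
  obtain \<tau> where \<tau>: "\<And>i. i < length as \<Longrightarrow> tvars (\<tau> i) \<subseteq> {..<length bs}"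
    "\<And>i. i < length as \<Longrightarrow> as ! i = tval M (nth bs) (\<tau> i)"
    using generating_tuple_terms[OF bs] as by (auto simp: generating_tuple_def)
  have "tval M (\<lambda>j. tval M (nth as) (\<sigma> j)) (\<tau> i) = tval M (nth bs) (\<tau> i)" if "i < length as" for i
    using \<tau>(1)[OF that] \<sigma>(2) by (intro tval_cong) auto
  then have "mutually_inverse \<sigma> \<tau> (length as) \<in> qf_type M as"
    using mutually_inverse_formula[OF \<sigma>(1) \<tau>(1)] \<tau>(2) by (simp add: qf_type_def sat_mutually_inverse)
  from cb_derivative_pull_back[OF univ \<sigma>(1) \<tau>(1) d this]
  show ?thesis using pull_back_qf_type[OF \<sigma>(1) refl \<sigma>(2)] by simp
qed

section \<open>Prime ideals over types\<close>

text \<open>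
  Here \<open>E s t\<close> is the set of ring elements whose vanishing expresses the equation \<open>s = t\<close>.
\<close>

definition lies_over :: "(gterm \<Rightarrow> gterm \<Rightarrow> 'r set) \<Rightarrow> nat \<Rightarrow> 'r set \<Rightarrow> gformula set \<Rightarrow> bool" where
  "lies_over E n P p \<longleftrightarrow> (\<forall>s t. tvars s \<subseteq> {..<n} \<longrightarrow> tvars t \<subseteq> {..<n} \<longrightarrow> (FEq s t \<in> p \<longleftrightarrow> E s t \<subseteq> P))"

lemma lies_over_unique:
  "p \<in> qf_types T n \<Longrightarrow> q \<in> qf_types T n \<Longrightarrow> lies_over E n P p \<Longrightarrow> lies_over E n P q \<Longrightarrow> p = q"
  by (rule qf_type_eqI) (auto simp: lies_over_def)

text \<open>
  The neighbourhoods of \<open>p\<close> are indexed by the formulas \<open>f \<in> p\<close>; the one for \<open>f\<close> consists of the admissible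
  primes over types containing \<open>f\<close>. The limit prime contains the elements expressing an equation of
  \<open>p\<close> because the primes in a small enough neighbourhood do; it does not contain all those of a negated
  equation because some prime above it does not. The predicate \<open>C\<close> carries along the restriction to
  primes of large rank.
\<close>

lemma prime_over_limit_type:
  assumes A: "ring_subset A" "ideal_chains_stabilise A"
    and E: "\<And>s t. tvars s \<subseteq> {..<n} \<Longrightarrow> tvars t \<subseteq> {..<n} \<Longrightarrow> E s t \<subseteq> A"
    and p: "p \<in> qf_types T n"
    and dense: "\<And>f. f \<in> p \<Longrightarrow>
      \<exists>Q q. prime_in A Q \<and> q \<in> qf_types T n \<and> f \<in> q \<and> lies_over E n Q q \<and> C Q q"
  obtains P Q q where "prime_in A P" "lies_over E n P p"
    "P \<subseteq> Q" "prime_in A Q" "lies_over E n Q q" "C Q q"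
proof -
  define F where "F f = {Q. \<exists>q. prime_in A Q \<and> q \<in> qf_types T n \<and> f \<in> q \<and> lies_over E n Q q \<and> C Q q}" for f
  have F_conj: "F (FConj f g) = F (FConj f g) \<inter> F f \<inter> F g" for f g
    using conj_in_qf_type unfolding F_def by blast
  have ne: "F ` p \<noteq> {}" using true_in_qf_type[OF p] by auto
  have prime: "prime_in A Q" if "D \<in> F ` p" "Q \<in> D" for D Q
    using that by (auto simp: F_def)
  have inhabited: "D \<noteq> {}" if "D \<in> F ` p" for D
    using that dense unfolding F_def by blast
  have directed: "\<exists>D\<in>F ` p. D \<subseteq> D1 \<inter> D2" if "D1 \<in> F ` p" "D2 \<in> F ` p" for D1 D2
  proof -
    from that obtain f g where fg: "f \<in> p" "g \<in> p" "D1 = F f" "D2 = F g" by auto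
    then have "F (FConj f g) \<in> F ` p" using conj_in_qf_type[OF p] by auto
    then show ?thesis using F_conj[of f g] fg(3,4) by auto
  qed
  obtain P where P: "prime_in A P" and below: "\<forall>D\<in>F ` p. \<exists>Q\<in>D. P \<subseteq> Q"
    and avoid: "\<forall>a\<in>A - P. \<exists>D\<in>F ` p. \<forall>Q\<in>D. P \<subseteq> Q \<longrightarrow> a \<notin> Q"
    by (rule prime_limit[OF A ne prime inhabited directed])
  have "FEq s t \<in> p \<longleftrightarrow> E s t \<subseteq> P" if st: "tvars s \<subseteq> {..<n}" "tvars t \<subseteq> {..<n}" for s t
  proof
    assume eq: "FEq s t \<in> p"
    show "E s t \<subseteq> P"
    proof (rule ccontr)
      assume "\<not> E s t \<subseteq> P"
      then obtain a where a: "a \<in> E s t" "a \<notin> P" by auto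
      then have "a \<in> A - P" using E[OF st] by auto
      then obtain f where f: "f \<in> p" "\<forall>Q\<in>F f. P \<subseteq> Q \<longrightarrow> a \<notin> Q"
        using bspec[OF avoid] by blast
      have "F (FConj f (FEq s t)) \<in> F ` p" using conj_in_qf_type[OF p] eq f(1) by auto
      then obtain Q where Q: "Q \<in> F (FConj f (FEq s t))" "P \<subseteq> Q" using below by blast
      then have "Q \<in> F f" "Q \<in> F (FEq s t)" using F_conj by blast+
      then have "a \<in> Q" using a(1) st by (auto simp: F_def lies_over_def)
      then show False using f(2) \<open>Q \<in> F f\<close> Q(2) by blast
    qed
  next
    assume sub: "E s t \<subseteq> P"
    have form: "FEq s t \<in> qf_formulas n" using st by (simp add: qf_formulas_def)
    show "FEq s t \<in> p"
    proof (rule ccontr)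
      assume "FEq s t \<notin> p"
      then have "FNeg (FEq s t) \<in> p" using p form by (auto simp: qf_types_def)
      then obtain Q where Q: "Q \<in> F (FNeg (FEq s t))" "P \<subseteq> Q" using below by blast
      then obtain q where q: "q \<in> qf_types T n" "FNeg (FEq s t) \<in> q" "lies_over E n Q q"
        by (auto simp: F_def)
      have "FEq s t \<in> q" using q(3) st sub Q(2) by (auto simp: lies_over_def)
      with q(1,2) show False by (elim qf_typesE) (auto simp: qf_type_def)
    qed
  qed
  then have over: "lies_over E n P p" by (simp add: lies_over_def)
  obtain Q where Q: "Q \<in> F (FEq TOne TOne)" "P \<subseteq> Q"
    using below true_in_qf_type[OF p] by blast
  then obtain q where "prime_in A Q" "lies_over E n Q q" "C Q q" by (auto simp: F_def)
  with P over Q(2) show ?thesis by (rule that)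
qed

text \<open>
  In the induction step the limit prime is strictly below one of the primes of rank at least \<open>d\<close>,
  because the types below them differ; hence its rank is at least \<open>d + 1\<close>.
\<close>

theorem cb_derivative_prime_rank:
  assumes A: "ring_subset A" "ideal_chains_stabilise A" and \<phi>: "strict_prime_rank A \<phi> b"
    and E: "\<And>s t. tvars s \<subseteq> {..<n} \<Longrightarrow> tvars t \<subseteq> {..<n} \<Longrightarrow> E s t \<subseteq> A"
    and points: "\<And>p f. p \<in> qf_types T n \<Longrightarrow> f \<in> p \<Longrightarrow>
      \<exists>Q q. prime_in A Q \<and> q \<in> qf_types T n \<and> f \<in> q \<and> lies_over E n Q q"
  shows "p \<in> cb_derivative (qf_type_space T n) (d::nat) \<Longrightarrow>
    \<exists>P. prime_in A P \<and> lies_over E n P p \<and> d \<le> \<phi> P"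
proof (induction d arbitrary: p)
  case 0
  then have p: "p \<in> qf_types T n" by (simp add: cb_derivative_0_qf)
  have dense: "\<exists>Q q. prime_in A Q \<and> q \<in> qf_types T n \<and> f \<in> q \<and> lies_over E n Q q \<and> True" if "f \<in> p" for f
    using points[OF p that] by simp
  obtain P where "prime_in A P" "lies_over E n P p"
    using prime_over_limit_type[OF A, where E=E and n=n and p=p and T=T and C="\<lambda>_ _. True",
        OF E p dense] by blast
  then show ?case by auto
next
  case (Suc d)
  let ?D = "cb_derivative (qf_type_space T n) d"
  have p: "p \<in> ?D" "\<And>f. f \<in> p \<Longrightarrow> \<exists>q\<in>?D. f \<in> q \<and> q \<noteq> p"
    using Suc.prems unfolding cb_derivative_Suc non_isolated_qf_type_iff[OF cb_derivative_qf_types]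
    by blast+
  have S: "q \<in> qf_types T n" if "q \<in> ?D" for q using that cb_derivative_qf_types by blast
  define C where "C Q q \<longleftrightarrow> d \<le> \<phi> Q \<and> q \<in> ?D \<and> q \<noteq> p" for Q q
  have dense: "\<exists>Q q. prime_in A Q \<and> q \<in> qf_types T n \<and> f \<in> q \<and> lies_over E n Q q \<and> C Q q" if "f \<in> p" for f
  proof -
    obtain q where q: "q \<in> ?D" "f \<in> q" "q \<noteq> p" using p(2) \<open>f \<in> p\<close> by blast
    then show ?thesis using Suc.IH[OF q(1)] S[OF q(1)] by (auto simp: C_def)
  qed
  obtain P Q q where P: "prime_in A P" "lies_over E n P p"
    and Q: "P \<subseteq> Q" "prime_in A Q" "lies_over E n Q q" "C Q q"
    by (rule prime_over_limit_type[OF A, where E=E and n=n and p=p and T=T and C=C,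
        OF E S[OF p(1)] dense])
  have "P \<noteq> Q" using lies_over_unique[OF S S, of p q] p(1) P(2) Q(3,4) by (auto simp: C_def)
  then have "\<phi> Q < \<phi> P" using \<phi> P(1) Q(1,2) by (auto simp: strict_prime_rank_def)
  then show ?case using P Q(4) by (intro exI[of _ P]) (auto simp: C_def)
qed

section \<open>Function algebras\<close>

text \<open>
  A copy of the field in the ring of functions: it has two ideals and one prime, which starts the
  recursion over generators.
\<close>

definition constant_functions :: "('x \<Rightarrow> 'k::field) set" where
  "constant_functions = range (\<lambda>c _. c)"

lemma constant_functions_ring: "ring_subset (constant_functions :: ('x \<Rightarrow> 'k::field) set)"
proof
  show "1 \<in> constant_functions" by (auto simp: constant_functions_def fun_eq_iff)
  fix f g :: "'x \<Rightarrow> 'k" assume "f \<in> constant_functions" "g \<in> constant_functions"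
  then obtain a b where "f = (\<lambda>_. a)" "g = (\<lambda>_. b)" by (auto simp: constant_functions_def)
  then have "f - g = (\<lambda>_. a - b)" "f * g = (\<lambda>_. a * b)" by (auto simp: fun_eq_iff)
  then show "f - g \<in> constant_functions" "f * g \<in> constant_functions"
    by (auto simp: constant_functions_def)
qed

lemma constant_functions_ideal:
  assumes I: "ideal_in constant_functions I"
  shows "I = {0} \<or> I = constant_functions"
proof (cases "I \<subseteq> {0}")
  case True
  then show ?thesis using ideal_zero[OF I] by auto
next
  case False
  then obtain f where f: "f \<in> I" "f \<noteq> 0" by auto
  then obtain a where a: "f = (\<lambda>_. a)" using ideal_sub[OF I] by (auto simp: constant_functions_def)
  then have "a \<noteq> 0" using f(2) by (auto simp: fun_eq_iff)
  have "(\<lambda>_. c) \<in> I" for c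
  proof -
    have "(\<lambda>_. c / a) * f \<in> I" using f(1) by (intro ideal_mult[OF I]) (auto simp: constant_functions_def)
    moreover have "(\<lambda>_. c / a) * f = (\<lambda>_. c)" using a \<open>a \<noteq> 0\<close> by (auto simp: fun_eq_iff)
    ultimately show ?thesis by simp
  qed
  then have "constant_functions \<subseteq> I" by (auto simp: constant_functions_def)
  then show ?thesis using ideal_sub[OF I] by auto
qed

lemma constant_functions_stabilise:
  "ideal_chains_stabilise (constant_functions :: ('x \<Rightarrow> 'k::field) set)"
  unfolding ideal_chains_stabilise_def
proof (intro allI impI, elim conjE)
  fix I :: "nat \<Rightarrow> ('x \<Rightarrow> 'k) set"
  assume I: "\<forall>k. ideal_in constant_functions (I k)" and inc: "incseq I"
  show "\<exists>k. \<forall>j\<ge>k. I j = I k"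
  proof (cases "\<exists>k. I k = constant_functions")
    case True
    then obtain k where k: "I k = constant_functions" by auto
    have "I j = constant_functions" if "k \<le> j" for j
      using incseqD[OF inc that] k I ideal_sub by blast
    then show ?thesis using k by (intro exI[of _ k]) simp
  next
    case False
    then have "I k = {0}" for k using I constant_functions_ideal by blast
    then show ?thesis by simp
  qed
qed

lemma constant_functions_prime_rank:
  "strict_prime_rank (constant_functions :: ('x \<Rightarrow> 'k::field) set) (\<lambda>_. 0) 0"
proof -
  have "P = {0}" if "prime_in constant_functions P" for P :: "('x \<Rightarrow> 'k) set"
    using that constant_functions_ideal[of P] ring_subset.one_mem[OF constant_functions_ring]
    by (auto simp: prime_in_def)
  then show ?thesis unfolding strict_prime_rank_def by blast
qed

lemma finitely_generated_function_algebra: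
  fixes xs :: "('x \<Rightarrow> 'k::field) list"
  obtains A \<phi> b where "ring_subset A" "ideal_chains_stabilise A" "strict_prime_rank A \<phi> b"
    "constant_functions \<subseteq> A" "set xs \<subseteq> A"
proof -
  have "\<exists>A \<phi> b. ring_subset A \<and> ideal_chains_stabilise A \<and> strict_prime_rank A \<phi> b
      \<and> constant_functions \<subseteq> A \<and> set xs \<subseteq> A"
  proof (induction xs)
    case Nil
    then show ?case
      using constant_functions_ring constant_functions_stabilise constant_functions_prime_rank by auto
  next
    case (Cons x xs)
    then obtain A \<phi> b where A: "ring_subset A" "ideal_chains_stabilise A" "strict_prime_rank A \<phi> b"
      "constant_functions \<subseteq> A" "set xs \<subseteq> A" by blast
    interpret ring_subset A by fact
    have "A \<subseteq> adjoin A x" using mem_adjoin by auto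
    moreover have "x \<in> adjoin A x" by (rule adjoined_mem)
    ultimately have "constant_functions \<subseteq> adjoin A x" "set (x # xs) \<subseteq> adjoin A x"
      using A(4,5) by auto
    then show ?case
      using ring_subset_adjoin[of x] hilbert_basis[OF A(2), of x] strict_prime_rank_adjoin[OF A(3), of x]
      by blast
  qed
  then show ?thesis using that by blast
qed

lemma point_prime:
  assumes "ring_subset A"
  shows "prime_in A {f \<in> A. f a = (0::'k::field)}"
proof -
  interpret ring_subset A by fact
  show ?thesis
    by (auto simp: prime_in_def ideal_in_def zero_mem add_mem mult_mem)
qed

section \<open>Types of a linear group\<close>

lemma holds_foldr_FAll: "holds M (foldr FAll is f) \<longleftrightarrow> holds M f"
proof (induction "is")
  case (Cons i "is")
  have "holds M (FAll i g) \<longleftrightarrow> holds M g" for g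
  proof
    assume g: "holds M (FAll i g)"
    show "holds M g"
      unfolding holds_def
    proof (intro allI impI)
      fix e :: "nat \<Rightarrow> 'a" assume e: "range e \<subseteq> carrier M"
      then have "sat M (e(i := e i)) g" using g unfolding holds_def sat.simps by blast
      then show "sat M e g" by simp
    qed
  next
    assume g: "holds M g"
    have "sat M (e(i := a)) g" if "range e \<subseteq> carrier M" "a \<in> carrier M" for e a
    proof -
      have "range (e(i := a)) \<subseteq> carrier M" using that by auto
      then show ?thesis using g by (simp add: holds_def)
    qed
    then show "holds M (FAll i g)" by (simp add: holds_def)
  qed
  then show ?case using Cons by simp
qed simp

lemma fvars_foldr_FAll: "fvars (foldr FAll is f) = fvars f - set is"
  by (induction "is") auto

text \<open>
  If \<open>f\<close> had no solution in \<open>G\<close>, then the universal closure of its negation would belong to the universal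
  theory, and so it would hold in the model that realises the type.
\<close>

lemma qf_formula_realised:
  assumes G: "group G" and p: "p \<in> qf_types (universal_theory G) n" "f \<in> p"
  obtains as where "length as = n" "set as \<subseteq> carrier G" "f \<in> qf_type G as"
proof -
  obtain M :: "nat monoid" and bs where M: "model (universal_theory G) M" "length bs = n"
    "set bs \<subseteq> carrier M" "p = qf_type M bs"
    using p(1) by (rule qf_typesE)
  have f: "f \<in> qf_formulas n" "sat M (nth bs) f"
    using p(2) M(2,4) by (auto simp: qf_type_def)
  have "\<not> holds M (FNeg f)"
  proof
    assume h: "holds M (FNeg f)"
    \<comment> \<open>Assignments are total; the values beyond \<open>n\<close> are immaterial for \<open>f\<close>.\<close>
    define e where "e i = (if i < n then bs ! i else \<one>\<^bsub>M\<^esub>)" for i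
    have "group M" using M(1) by (simp add: model_def)
    then have "range e \<subseteq> carrier M"
      using M(2,3) by (auto simp: e_def intro: monoid.one_closed group.is_monoid)
    then have "\<not> sat M e f" using h by (simp add: holds_def)
    moreover have "sat M e f \<longleftrightarrow> sat M (nth bs) f"
      by (rule sat_cong) (use f(1) in \<open>auto simp: e_def qf_formulas_def\<close>)
    ultimately show False using f(2) by simp
  qed
  then have "foldr FAll [0..<n] (FNeg f) \<notin> universal_theory G"
    using M(1) by (auto simp: model_def holds_foldr_FAll)
  moreover have "universal_sentence (foldr FAll [0..<n] (FNeg f))"
    unfolding universal_sentence_def fvars_foldr_FAll
    using f(1) by (intro conjI exI[of _ "[0..<n]"] exI[of _ "FNeg f"]) (auto simp: qf_formulas_def)
  ultimately have "\<not> holds G (FNeg f)" by (auto simp: universal_theory_def holds_foldr_FAll)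
  then obtain e where e: "range e \<subseteq> carrier G" "sat G e f" by (auto simp: holds_def)
  have "sat G (nth (map e [0..<n])) f \<longleftrightarrow> sat G e f"
    by (rule sat_cong) (use f(1) in \<open>auto simp: qf_formulas_def\<close>)
  then have "f \<in> qf_type G (map e [0..<n])" using f(1) e(2) by (simp add: qf_type_def)
  then show ?thesis using that[of "map e [0..<n]"] e(1) by auto
qed

lemma linear_groupE:
  fixes G :: "'k::field mat monoid"
  assumes "linear_group G"
  obtains m where "group G" "carrier G \<subseteq> carrier_mat m m" "\<And>a b. a \<otimes>\<^bsub>G\<^esub> b = a * b" "\<one>\<^bsub>G\<^esub> = 1\<^sub>m m"
proof -
  obtain m H where H: "subgroup H (GL TYPE('k) m)" "G = (GL TYPE('k) m)\<lparr>carrier := H\<rparr>"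
    using assms by (auto simp: linear_group_def)
  interpret R: ring "ring_mat TYPE('k) m ()" by (rule ring_mat)
  have "group (GL TYPE('k) m)" unfolding GL_def by (rule R.units_group)
  then have "group G" unfolding H(2) using H(1) by (intro subgroup.subgroup_is_group)
  moreover have "carrier G \<subseteq> carrier_mat m m"
    using subgroup.subset[OF H(1)] H(2)
    by (auto simp: GL_def units_of_carrier Units_def ring_mat_simps)
  moreover have "a \<otimes>\<^bsub>G\<^esub> b = a * b" for a b
    by (simp add: H(2) GL_def units_of_mult ring_mat_simps)
  moreover have "\<one>\<^bsub>G\<^esub> = 1\<^sub>m m"
    by (simp add: H(2) GL_def units_of_one ring_mat_simps)
  ultimately show ?thesis by (rule that)
qed

text \<open>
  The algebra is generated by the entries of the coordinates and of their inverses; the entries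
  of all words belong to it by the formula for matrix products, once inverses have been pushed down
  to the variables. Points of \<open>G\<^sup>n\<close> give the primes from which the limits start.
\<close>

theorem linear_group_cb_derivative_empty:
  fixes G :: "'k::field mat monoid"
  assumes "linear_group G"
  obtains d :: nat where "cb_derivative (qf_type_space (universal_theory G) n) d = {}"
proof -
  obtain m where G: "group G" "carrier G \<subseteq> carrier_mat m m"
    "\<And>a b. a \<otimes>\<^bsub>G\<^esub> b = a * b" "\<one>\<^bsub>G\<^esub> = 1\<^sub>m m"
    using linear_groupE[OF assms] by metis
  interpret group G by (rule G(1))
  \<comment> \<open>Tuples outside \<open>G\<^sup>n\<close> are evaluated as if they were trivial. So all words have values in \<open>G\<close>, and
    identities between words become identities between functions on all lists.\<close>
  define env :: "'k mat list \<Rightarrow> nat \<Rightarrow> 'k mat" where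
    "env as i = (if length as = n \<and> set as \<subseteq> carrier G \<and> i < n then as ! i else \<one>\<^bsub>G\<^esub>)" for as i
  have env: "env as i \<in> carrier G" for as i by (auto simp: env_def)
  define entry where "entry t i j = (\<lambda>as. tval G (env as) t $$ (i, j))" for t i j
  have val: "tval G (env as) t \<in> carrier G" for as t
    by (rule tval_closed[OF G(1) env])
  have val_mat: "tval G (env as) t \<in> carrier_mat m m" for as t
    using val G(2) by blast
  have entry_mult: "entry (TMult s t) i j = (\<Sum>k<m. entry s i k * entry t k j)" if "i < m" "j < m" for s t i j
  proof
    fix as
    have sum_app: "(\<Sum>k\<in>S. F k) x = (\<Sum>k\<in>S. F k x)" for F :: "nat \<Rightarrow> 'k mat list \<Rightarrow> 'k" and S x
      by (induction S rule: infinite_finite_induct) auto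
    show "entry (TMult s t) i j as = (\<Sum>k<m. entry s i k * entry t k j) as"
      using that val_mat[of as s] val_mat[of as t]
      by (auto simp: entry_def sum_app G(3) scalar_prod_def lessThan_atLeast0 intro!: sum.cong)
  qed
  have entry_inv_mult: "entry (TInv (TMult s t)) i j = entry (TMult (TInv t) (TInv s)) i j"
    and entry_inv_inv: "entry (TInv (TInv t)) i j = entry t i j"
    and entry_inv_one: "entry (TInv TOne) i j = entry TOne i j" for s t i j
    using val by (simp_all add: entry_def inv_mult_group)
  define gens where "gens = concat (map (\<lambda>t. concat (map (\<lambda>i. map (entry t i) [0..<m]) [0..<m]))
    (map TVar [0..<n] @ map (\<lambda>l. TInv (TVar l)) [0..<n]))"
  obtain A \<phi> b where A: "ring_subset A" "ideal_chains_stabilise A" "strict_prime_rank A \<phi> b"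
    "constant_functions \<subseteq> A" "set gens \<subseteq> A"
    by (rule finitely_generated_function_algebra)
  interpret A: ring_subset A by (rule A(1))
  have entry_one: "entry TOne i j \<in> A" if "i < m" "j < m" for i j
  proof -
    have "entry TOne i j = (\<lambda>_. 1\<^sub>m m $$ (i, j))" by (simp add: entry_def G(4))
    then show ?thesis using A(4) by (auto simp: constant_functions_def)
  qed
  have entries: "\<forall>i<m. \<forall>j<m. entry t i j \<in> A \<and> entry (TInv t) i j \<in> A" if "tvars t \<subseteq> {..<n}" for t
    using that
  proof (induction t)
    case (TVar l)
    then have "l < n" by simp
    then have "entry (TVar l) i j \<in> set gens" "entry (TInv (TVar l)) i j \<in> set gens"
      if "i < m" "j < m" for i j
      using that \<open>l < n\<close> by (force simp: gens_def)+
    then show ?case using A(5) by auto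
  next
    case TOne
    then show ?case using entry_one by (simp add: entry_inv_one)
  next
    case (TInv t)
    then show ?case by (simp add: entry_inv_inv)
  next
    case (TMult s t)
    then show ?case by (auto simp: entry_inv_mult entry_mult intro!: A.sum_mem A.mult_mem)
  qed
  define E where "E s t = {entry s i j - entry t i j | i j. i < m \<and> j < m}" for s t
  have E: "E s t \<subseteq> A" if "tvars s \<subseteq> {..<n}" "tvars t \<subseteq> {..<n}" for s t
    using entries[OF that(1)] entries[OF that(2)] by (auto simp: E_def intro!: A.diff_mem)
  let ?T = "universal_theory G"
  have modelG: "model ?T G" using G(1) by (simp add: model_def universal_theory_def)
  have points: "\<exists>Q q. prime_in A Q \<and> q \<in> qf_types ?T n \<and> f \<in> q \<and> lies_over E n Q q"
    if p: "p \<in> qf_types ?T n" "f \<in> p" for p f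
  proof -
    obtain as where as: "length as = n" "set as \<subseteq> carrier G" "f \<in> qf_type G as"
      using qf_formula_realised[OF G(1) p] by blast
    define Q where "Q = {g \<in> A. g as = 0}"
    have "FEq s t \<in> qf_type G as \<longleftrightarrow> E s t \<subseteq> Q" if st: "tvars s \<subseteq> {..<n}" "tvars t \<subseteq> {..<n}" for s t
    proof -
      have same: "tval G (nth as) u = tval G (env as) u" if "tvars u \<subseteq> {..<n}" for u
        using that as(1,2) by (intro tval_cong) (auto simp: env_def)
      have "E s t \<subseteq> Q \<longleftrightarrow> (\<forall>i<m. \<forall>j<m. entry s i j as = entry t i j as)"
      proof -
        have "E s t \<subseteq> Q \<longleftrightarrow> (\<forall>g\<in>E s t. g as = 0)" using E[OF st] by (auto simp: Q_def)
        also have "\<dots> \<longleftrightarrow> (\<forall>i<m. \<forall>j<m. (entry s i j - entry t i j) as = 0)" unfolding E_def by blast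
        finally show ?thesis by simp
      qed
      also have "\<dots> \<longleftrightarrow> tval G (env as) s = tval G (env as) t"
        using val_mat[of as s] val_mat[of as t] by (auto simp: entry_def intro!: eq_matI)
      finally show ?thesis
        using st as(1) by (simp add: qf_type_def qf_formulas_def same)
    qed
    then have "lies_over E n Q (qf_type G as)" by (simp add: lies_over_def)
    moreover have "prime_in A Q" unfolding Q_def by (rule point_prime[OF A(1)])
    moreover have "qf_type G as \<in> qf_types ?T n"
      using qf_type_in_qf_types[OF modelG _ as(2)] as(1) by (auto simp: universal_theory_def)
    ultimately show ?thesis using as(3) by blast
  qed
  have "cb_derivative (qf_type_space ?T n) (Suc b) = {}"
  proof (rule ccontr)
    assume "cb_derivative (qf_type_space ?T n) (Suc b) \<noteq> {}"
    then obtain p where "p \<in> cb_derivative (qf_type_space ?T n) (Suc b)" by auto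
    from cb_derivative_prime_rank[OF A(1-3), where E=E and n=n and T="?T", OF _ _ this]
    have "\<exists>P. prime_in A P \<and> lies_over E n P p \<and> Suc b \<le> \<phi> P"
      using E points by blast
    then obtain P where "prime_in A P" "Suc b \<le> \<phi> P" by blast
    then show False using A(3) by (auto simp: strict_prime_rank_def)
  qed
  then show ?thesis by (rule that)
qed

theorem theorem0p4:
  fixes G :: "'k::field mat monoid" and L :: "'b monoid"
  assumes "linear_group G"
    and "model (universal_theory G) L"
    and "finitely_generated L"
  shows "\<exists>k::nat. has_Rk (universal_theory G) L k"
proof -
  let ?T = "universal_theory G"
  let ?D = "\<lambda>n (d::nat). cb_derivative (qf_type_space ?T n) d"
  have univ: "universal_sentence f" if "f \<in> ?T" for f
    using that by (simp add: universal_theory_def)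
  obtain as where as: "generating_tuple L as"
    using assms(3) by (auto simp: finitely_generated_def)
  let ?p = "qf_type L as"
  obtain N where N: "?D (length as) N = {}"
    using linear_group_cb_derivative_empty[OF assms(1)] by metis
  have p0: "?p \<in> ?D (length as) 0"
    using qf_type_in_qf_types[OF assms(2) univ] as
    by (simp add: cb_derivative_0_qf generating_tuple_def)
  obtain d where d: "?p \<in> ?D (length as) d" "?p \<notin> ?D (length as) (Suc d)"
  proof -
    have "\<exists>d. ?p \<in> ?D (length as) d \<and> ?p \<notin> ?D (length as) (Suc d)"
    proof (rule ccontr)
      assume "\<not> ?thesis"
      then have "?p \<in> ?D (length as) k" for k using p0 by (induction k) auto
      then show False using N by blast
    qed
    then show ?thesis using that by blast
  qed
  have "has_Rk_at ?T L bs (Suc d)" if bs: "generating_tuple L bs" for bs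
  proof -
    have "qf_type L bs \<in> ?D (length bs) d"
      by (rule cb_derivative_generating_tuple[OF univ as bs d(1)])
    moreover have "qf_type L bs \<notin> ?D (length bs) (Suc d)"
      using cb_derivative_generating_tuple[OF univ bs as] d(2) by blast
    ultimately have "has_cb_rank (qf_type_space ?T (length bs)) (qf_type L bs) d"
      by (simp add: has_cb_rank_def cb_derivative_Suc)
    then show ?thesis unfolding has_Rk_at_def by (intro exI[of _ d]) auto
  qed
  then show ?thesis using assms(3) unfolding has_Rk_def by blast
qed

end
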